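(* Let $x\in[0,1)$, let $\Theta$ be a (measurable) set of types $\theta=(\gamma,c,\sigma)$ with probability measure $\pi$, and let $\mu:[0,\infty)\to\mathbb R$, $\lambda:[0,\infty)\to[0,\infty)$. Assume: (I1) the insurer chooses contracts from the compact set $\mathcal K:=[0,p_{\max}]\times[0,\alpha_{\max}]\times[0,\beta_{\max}]$, where $0\le p_{\max}<\infty$, $0\le\alpha_{\max}<\infty$, $0\le\beta_{\max}<1$; (I2) efforts and the mean-field effort are restricted to $[0,E_{\max}]$ with $E_{\max}<\infty$; $\mu$ and $\lambda$ are continuous and convex on $[0,(1+x)E_{\max}]$; and $\gamma(\theta),c(\theta),\sigma(\theta)$ are measurable with $0<\gamma(\theta)\le\gamma_{\max}$, $0\le c(\theta)\le c_{\max}$, $0\le\sigma(\theta)\le\sigma_{\max}$ for all $\theta\in\Theta$, for some $\gamma_{\max},c_{\max},\sigma_{\max}\in(0,\infty)$ (consequently, for every $k\in\mathcal K$ the set $\mathcal M(k)$ of mean-field Nash equilibria induced by $k$ is nonempty). Define $$\mathcal J^{\mathrm{worst}}(k):=\inf_{M\in\mathcal M(k)}J(k;M),\qquad \mathcal J^{\mathrm{best}}(k):=\sup_{M\in\mathcal M(k)}J(k;M),\qquad k\in\mathcal K.$$ Then both $\mathcal J^{\mathrm{worst}}$ and $\mathcal J^{\mathrm{best}}$ are well-defined insurer performance criteria and are bounded above on $\mathcal K$. Consequently, for every $\varepsilon>0$ there exist $k_\varepsilon^{\mathrm{worst}},k_\varepsilon^{\mathrm{best}}\in\mathcal K$ such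 that $$\mathcal J^{\mathrm{worst}}(k_\varepsilon^{\mathrm{worst}})\ge\sup_{k\in\mathcal K}\mathcal J^{\mathrm{worst}}(k)-\varepsilon,\qquad \mathcal J^{\mathrm{best}}(k_\varepsilon^{\mathrm{best}})\ge\sup_{k\in\mathcal K}\mathcal J^{\mathrm{best}}(k)-\varepsilon.$$
   Context: For a contract $k=(p,\alpha,\beta)$, $e,\tilde m\in[0,E_{\max}]$ and $\theta\in\Theta$ define $$\mathrm{CE}^{\mathrm{out}}(e;\theta,\tilde m)=\mu(e+x\tilde m)+c(\theta)e+\tfrac12\gamma(\theta)\lambda(e+x\tilde m),$$ $$\mathrm{CE}^{\mathrm{in}}(e;\theta,\tilde m)=p+(c(\theta)-\alpha)e+\tfrac12\gamma(\theta)\alpha^2\sigma(\theta)^2+(1-\beta)\mu(e+x\tilde m)+\tfrac12\gamma(\theta)(1-\beta)^2\lambda(e+x\tilde m),$$ $U^{\mathrm{out}}=-\exp\{\gamma(\theta)\mathrm{CE}^{\mathrm{out}}\}$, $U^{\mathrm{in}}=-\exp\{\gamma(\theta)\mathrm{CE}^{\mathrm{in}}\}$, $E^{\mathrm{out}}(\theta;\tilde m)=\arg\min_{e\in[0,E_{\max}]}\mathrm{CE}^{\mathrm{out}}(e;\theta,\tilde m)$ and $E^{\mathrm{in}}(\theta;\tilde m)=\arg\min_{e\in[0,E_{\max}]}\mathrm{CE}^{\mathrm{in}}(e;\theta,\tilde m)$. $\mathcal M(k)$ is the set of mean-field Nash equilibria $M=(\tilde m,\{e^{\mathrm{in}}(\theta),e^{\mathrm{out}}(\theta),q(\theta)\}_{\theta\in\Theta})$,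 i.e. tuples with $\tilde m\in[0,E_{\max}]$ and measurable components such that (1) $e^{\mathrm{out}}(\theta)\in E^{\mathrm{out}}(\theta;\tilde m)$, $e^{\mathrm{in}}(\theta)\in E^{\mathrm{in}}(\theta;\tilde m)$ for every $\theta$; (2) $q(\theta)\in[0,1]$, $q(\theta)=1$ if $U^{\mathrm{in}}(e^{\mathrm{in}}(\theta);\theta,\tilde m)>U^{\mathrm{out}}(e^{\mathrm{out}}(\theta);\theta,\tilde m)$, $q(\theta)=0$ if the strict inequality is reversed, arbitrary in $[0,1]$ in case of equality; (3) $\tilde m=\int_\Theta[q(\theta)e^{\mathrm{in}}(\theta)+(1-q(\theta))e^{\mathrm{out}}(\theta)]\,d\pi(\theta)$. The insurer's per-capita expected profit is $$J(k;M)=\int_\Theta\big(p-\alpha e^{\mathrm{in}}(\theta)-\beta\mu(e^{\mathrm{in}}(\theta)+x\tilde m)\big)q(\theta)\,d\pi(\theta).$$ An insurer performance criterion is a measurable function $\mathcal J:\mathcal K\to\mathbb R$ that assigns to each contract $k$ a single payoff value used to evaluate it, possibly by aggregating or selecting from the equilibrium payoff set $\mathbb J(k)=\{J(k;M):M\in\mathcal M(k)\}$. It is well defined if $\mathcal J(k)$ is a finite real number for every $k\in\mathcal K$. *)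

theory Defs
  imports "HOL-Probability.Probability"
begin

text \<open>
  The type space \<open>\<Theta>\<close> with its distribution is a probability space \<open>\<pi>\<close> with \<open>\<Theta> = space \<pi>\<close>;
  the characteristics of a type are real functions \<open>\<gamma>\<close>, \<open>c\<close>, \<open>\<sigma>\<close> on it.
  The total functions \<open>mu\<close> and \<open>lam\<close> (for \<open>\<mu>\<close> and \<open>\<lambda>\<close>) are only evaluated at arguments
  \<open>e + x * m \<ge> 0\<close>.
\<close>

type_synonym contract = "real \<times> real \<times> real"

text \<open>The tuple of the mean-field effort, the insured effort, the uninsured effort and the
  probability of buying the contract.\<close>

type_synonym 't profile = "real \<times> ('t \<Rightarrow> real) \<times> ('t \<Rightarrow> real) \<times> ('t \<Rightarrow> real)"

definition contract_set :: "real \<Rightarrow> real \<Rightarrow> real \<Rightarrow> contract set" where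
  "contract_set p_max \<alpha>_max \<beta>_max = {0..p_max} \<times> {0..\<alpha>_max} \<times> {0..\<beta>_max}"

definition CE_out ::
  "real \<Rightarrow> (real \<Rightarrow> real) \<Rightarrow> (real \<Rightarrow> real) \<Rightarrow> ('t \<Rightarrow> real) \<Rightarrow> ('t \<Rightarrow> real)
    \<Rightarrow> real \<Rightarrow> 't \<Rightarrow> real \<Rightarrow> real" where
  "CE_out x mu lam \<gamma> c e \<theta> m =
     mu (e + x * m) + c \<theta> * e + 1 / 2 * \<gamma> \<theta> * lam (e + x * m)"

definition CE_in ::
  "real \<Rightarrow> (real \<Rightarrow> real) \<Rightarrow> (real \<Rightarrow> real) \<Rightarrow> ('t \<Rightarrow> real) \<Rightarrow> ('t \<Rightarrow> real) \<Rightarrow> ('t \<Rightarrow> real)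
    \<Rightarrow> contract \<Rightarrow> real \<Rightarrow> 't \<Rightarrow> real \<Rightarrow> real" where
  "CE_in x mu lam \<gamma> c \<sigma> k e \<theta> m = (case k of (p, \<alpha>, \<beta>) \<Rightarrow>
     p + (c \<theta> - \<alpha>) * e + 1 / 2 * \<gamma> \<theta> * \<alpha>\<^sup>2 * (\<sigma> \<theta>)\<^sup>2
       + (1 - \<beta>) * mu (e + x * m) + 1 / 2 * \<gamma> \<theta> * (1 - \<beta>)\<^sup>2 * lam (e + x * m))"

definition U_out ::
  "real \<Rightarrow> (real \<Rightarrow> real) \<Rightarrow> (real \<Rightarrow> real) \<Rightarrow> ('t \<Rightarrow> real) \<Rightarrow> ('t \<Rightarrow> real)
    \<Rightarrow> real \<Rightarrow> 't \<Rightarrow> real \<Rightarrow> real" where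
  "U_out x mu lam \<gamma> c e \<theta> m = - exp (\<gamma> \<theta> * CE_out x mu lam \<gamma> c e \<theta> m)"

definition U_in ::
  "real \<Rightarrow> (real \<Rightarrow> real) \<Rightarrow> (real \<Rightarrow> real) \<Rightarrow> ('t \<Rightarrow> real) \<Rightarrow> ('t \<Rightarrow> real) \<Rightarrow> ('t \<Rightarrow> real)
    \<Rightarrow> contract \<Rightarrow> real \<Rightarrow> 't \<Rightarrow> real \<Rightarrow> real" where
  "U_in x mu lam \<gamma> c \<sigma> k e \<theta> m = - exp (\<gamma> \<theta> * CE_in x mu lam \<gamma> c \<sigma> k e \<theta> m)"

definition E_out ::
  "real \<Rightarrow> real \<Rightarrow> (real \<Rightarrow> real) \<Rightarrow> (real \<Rightarrow> real) \<Rightarrow> ('t \<Rightarrow> real) \<Rightarrow> ('t \<Rightarrow> real)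
    \<Rightarrow> 't \<Rightarrow> real \<Rightarrow> real set" where
  "E_out x E_max mu lam \<gamma> c \<theta> m =
     {e. is_arg_min (\<lambda>e. CE_out x mu lam \<gamma> c e \<theta> m) (\<lambda>e. e \<in> {0..E_max}) e}"

definition E_in ::
  "real \<Rightarrow> real \<Rightarrow> (real \<Rightarrow> real) \<Rightarrow> (real \<Rightarrow> real) \<Rightarrow> ('t \<Rightarrow> real) \<Rightarrow> ('t \<Rightarrow> real) \<Rightarrow> ('t \<Rightarrow> real)
    \<Rightarrow> contract \<Rightarrow> 't \<Rightarrow> real \<Rightarrow> real set" where
  "E_in x E_max mu lam \<gamma> c \<sigma> k \<theta> m =
     {e. is_arg_min (\<lambda>e. CE_in x mu lam \<gamma> c \<sigma> k e \<theta> m) (\<lambda>e. e \<in> {0..E_max}) e}"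

definition equilibria ::
  "'t measure \<Rightarrow> real \<Rightarrow> real \<Rightarrow> (real \<Rightarrow> real) \<Rightarrow> (real \<Rightarrow> real)
    \<Rightarrow> ('t \<Rightarrow> real) \<Rightarrow> ('t \<Rightarrow> real) \<Rightarrow> ('t \<Rightarrow> real) \<Rightarrow> contract \<Rightarrow> 't profile set" where
  "equilibria \<pi> x E_max mu lam \<gamma> c \<sigma> k = {(m, e_in, e_out, q).
     m \<in> {0..E_max} \<and>
     e_in \<in> borel_measurable \<pi> \<and> e_out \<in> borel_measurable \<pi> \<and> q \<in> borel_measurable \<pi> \<and>
     (\<forall>\<theta>\<in>space \<pi>.
        e_out \<theta> \<in> E_out x E_max mu lam \<gamma> c \<theta> m \<and>
        e_in \<theta> \<in> E_in x E_max mu lam \<gamma> c \<sigma> k \<theta> m) \<and>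
     (\<forall>\<theta>\<in>space \<pi>.
        q \<theta> \<in> {0..1} \<and>
        (U_in x mu lam \<gamma> c \<sigma> k (e_in \<theta>) \<theta> m > U_out x mu lam \<gamma> c (e_out \<theta>) \<theta> m \<longrightarrow> q \<theta> = 1) \<and>
        (U_in x mu lam \<gamma> c \<sigma> k (e_in \<theta>) \<theta> m < U_out x mu lam \<gamma> c (e_out \<theta>) \<theta> m \<longrightarrow> q \<theta> = 0)) \<and>
     m = (LINT \<theta>|\<pi>. q \<theta> * e_in \<theta> + (1 - q \<theta>) * e_out \<theta>)}"

definition profit ::
  "'t measure \<Rightarrow> real \<Rightarrow> (real \<Rightarrow> real) \<Rightarrow> contract \<Rightarrow> 't profile \<Rightarrow> real" where
  "profit \<pi> x mu k M = (case k of (p, \<alpha>, \<beta>) \<Rightarrow> case M of (m, e_in, e_out, q) \<Rightarrow>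
     LINT \<theta>|\<pi>. (p - \<alpha> * e_in \<theta> - \<beta> * mu (e_in \<theta> + x * m)) * q \<theta>)"

text \<open>
  Infimum and supremum are taken in the extended reals, so that finiteness of the criteria is a
  genuine claim: it fails when there is no equilibrium or when the payoff set is unbounded on the
  relevant side.
\<close>

definition J_worst ::
  "'t measure \<Rightarrow> real \<Rightarrow> real \<Rightarrow> (real \<Rightarrow> real) \<Rightarrow> (real \<Rightarrow> real)
    \<Rightarrow> ('t \<Rightarrow> real) \<Rightarrow> ('t \<Rightarrow> real) \<Rightarrow> ('t \<Rightarrow> real) \<Rightarrow> contract \<Rightarrow> ereal" where
  "J_worst \<pi> x E_max mu lam \<gamma> c \<sigma> k =
     (INF M\<in>equilibria \<pi> x E_max mu lam \<gamma> c \<sigma> k. ereal (profit \<pi> x mu k M))"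

definition J_best ::
  "'t measure \<Rightarrow> real \<Rightarrow> real \<Rightarrow> (real \<Rightarrow> real) \<Rightarrow> (real \<Rightarrow> real)
    \<Rightarrow> ('t \<Rightarrow> real) \<Rightarrow> ('t \<Rightarrow> real) \<Rightarrow> ('t \<Rightarrow> real) \<Rightarrow> contract \<Rightarrow> ereal" where
  "J_best \<pi> x E_max mu lam \<gamma> c \<sigma> k =
     (SUP M\<in>equilibria \<pi> x E_max mu lam \<gamma> c \<sigma> k. ereal (profit \<pi> x mu k M))"

definition well_defined_criterion :: "contract set \<Rightarrow> (contract \<Rightarrow> ereal) \<Rightarrow> bool" where
  "well_defined_criterion K \<J> \<longleftrightarrow>
     \<J> \<in> borel_measurable (restrict_space borel K) \<and> (\<forall>k\<in>K. \<bar>\<J> k\<bar> \<noteq> \<infinity>)"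

definition bounded_above_on :: "contract set \<Rightarrow> (contract \<Rightarrow> ereal) \<Rightarrow> bool" where
  "bounded_above_on K \<J> \<longleftrightarrow> (\<exists>B::real. \<forall>k\<in>K. \<J> k \<le> ereal B)"

end

theory Submission
  imports Defs
begin

text \<open>
  For every type the sets of optimal efforts are compact intervals depending upper
  semicontinuously on the contract and the mean effort. On the interval of optimal insured efforts
  the certainty equivalent, a sum of convex functions, is constant; since \<open>1 - \<beta> > 0\<close>, the function
  \<open>\<mu>\<close> is affine there. Hence the outcomes \<open>(q, q e, (1 - q) e', q g(e))\<close> available to a type, where
  \<open>g(e)\<close> is the insurer's profit from an insured agent, form a compact convex set, and integrals of measurable
  selections depend on the contract and the mean effort with compact graph and convex values.
  An equilibrium is a fixed point of such a correspondence on the interval \<open>[0, E_max]\<close>, and it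
  exists by connectedness. The pairs of contracts and equilibrium payoffs form a compact set, so the
  best and the worst payoff are bounded and semicontinuous in the contract.
\<close>

section \<open>Integrals of selections of convex sets\<close>

text \<open>Neither the optimal efforts nor \<open>q\<close> under indifference are unique, and
  \<open>\<pi>\<close> may have atoms. Convexity of the attainable integrals therefore cannot come
  from averaging over a nonatomic population; it has to hold type by type. This dictates the
  coordinates of an outcome: the mean-field condition and the payoff are linear in them, although
  not in \<open>(q, e, e')\<close>. The coordinates can also be inverted by division, so measurable
  selections are recovered by an explicit formula. Along a convergent sequence of parameters,
  selections need not have a pointwise convergent subsequence. Closedness is therefore a statement
  about integrals only, and the limiting selection may be unrelated to any pointwise limit.
  Contract, mean effort and the characteristics of a type are bundled into one Euclidean parameter,
  so that a single semicontinuity statement for minimizers yields both stability in the contract and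
  measurability in the type. Compactness of the payoff graph also keeps the measurability of the
  criteria elementary, since level sets become projections of countable unions of compact
  sets.\<close>

text \<open>The pointwise bound \<open>t \<le> \<delta> / 2 + t\<^sup>2 / (2 * \<delta>)\<close>
  takes the place of the Cauchy-Schwarz inequality. It turns \<open>L\<^sup>2\<close> estimates from
  the parallelogram law into the \<open>L\<^sup>1\<close> estimates that yield an almost everywhere
  Cauchy subsequence.\<close>

lemma (in prob_space) integral_norm_le_square:
  fixes u :: "'a \<Rightarrow> 'b::euclidean_space"
  assumes [measurable]: "u \<in> borel_measurable M"
    and bound: "\<And>\<omega>. \<omega> \<in> space M \<Longrightarrow> norm (u \<omega>) \<le> C"
    and "0 < \<delta>" "(LINT \<omega>|M. (norm (u \<omega>))\<^sup>2) < \<delta>\<^sup>2"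
  shows "(LINT \<omega>|M. norm (u \<omega>)) < \<delta>"
proof -
  have "integrable M (\<lambda>\<omega>. norm (u \<omega>))"
    by (rule integrable_const_bound[where B = C]) (auto simp: bound)
  moreover have int2: "integrable M (\<lambda>\<omega>. (norm (u \<omega>))\<^sup>2)"
    by (rule integrable_const_bound[where B = "C\<^sup>2"]) (auto simp: bound power_mono)
  moreover have "norm (u \<omega>) \<le> \<delta> / 2 + (norm (u \<omega>))\<^sup>2 / (2 * \<delta>)" for \<omega>
  proof -
    have "0 \<le> (norm (u \<omega>) - \<delta>)\<^sup>2 / (2 * \<delta>)"
      using \<open>0 < \<delta>\<close> by simp
    also have "\<dots> = \<delta> / 2 + (norm (u \<omega>))\<^sup>2 / (2 * \<delta>) - norm (u \<omega>)"
      using \<open>0 < \<delta>\<close> by (simp add: field_simps power2_eq_square)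
    finally show ?thesis by simp
  qed
  ultimately have "(LINT \<omega>|M. norm (u \<omega>)) \<le> (LINT \<omega>|M. \<delta> / 2 + (norm (u \<omega>))\<^sup>2 / (2 * \<delta>))"
    by (intro integral_mono) auto
  also have "\<dots> = \<delta> / 2 + (LINT \<omega>|M. (norm (u \<omega>))\<^sup>2) / (2 * \<delta>)"
    using int2 by (simp add: prob_space)
  also have "\<dots> < \<delta>"
    using assms(3,4) by (simp add: field_simps power2_eq_square)
  finally show ?thesis .
qed

text \<open>The parallelogram law solved for the difference: a lower bound on the norm of the
  midpoint becomes an upper bound on the distance.\<close>

lemma norm_diff_square_parallelogram:
  fixes u v :: "'b::real_inner"
  shows "(norm (u - v))\<^sup>2 = 2 * (norm u)\<^sup>2 + 2 * (norm v)\<^sup>2 - 4 * (norm ((1/2) *\<^sub>R u + (1/2) *\<^sub>R v))\<^sup>2"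
  by (simp add: power2_norm_eq_inner inner_diff inner_add algebra_simps inner_commute)

text \<open>
  Selections whose integrals are within \<open>1 / Suc n\<close> of the limit and whose \<open>L\<^sup>2\<close> norm is almost
  minimal among these form a Cauchy sequence, by the parallelogram law. This replaces weak
  compactness.
\<close>

lemma (in prob_space) convex_selection_integral_limit:
  fixes Q :: "'a \<Rightarrow> 'b::euclidean_space set" and h :: "nat \<Rightarrow> 'a \<Rightarrow> 'b"
  assumes convex: "\<And>\<omega>. \<omega> \<in> space M \<Longrightarrow> convex (Q \<omega>)"
    and closed: "\<And>\<omega>. \<omega> \<in> space M \<Longrightarrow> closed (Q \<omega>)"
    and bound: "\<And>\<omega> y. \<omega> \<in> space M \<Longrightarrow> y \<in> Q \<omega> \<Longrightarrow> norm y \<le> B"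
    and h: "\<And>n. h n \<in> borel_measurable M" "\<And>n \<omega>. \<omega> \<in> space M \<Longrightarrow> h n \<omega> \<in> Q \<omega>"
    and lim: "(\<lambda>n. LINT \<omega>|M. h n \<omega>) \<longlonglongrightarrow> y"
  shows "\<exists>f\<in>borel_measurable M. (\<forall>\<omega>\<in>space M. f \<omega> \<in> Q \<omega>) \<and> (LINT \<omega>|M. f \<omega>) = y"
proof -
  define \<eta> where "\<eta> n = inverse (real (Suc n))" for n
  have \<eta>_pos: "0 < \<eta> n" for n
    by (simp add: \<eta>_def)
  have \<eta>_mono: "\<eta> k \<le> \<eta> n" if "n \<le> k" for n k
    using that by (simp add: \<eta>_def)
  have \<eta>_lim: "\<eta> \<longlonglongrightarrow> 0"
    unfolding \<eta>_def by (rule LIMSEQ_inverse_real_of_nat)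
  define S where "S = {f \<in> borel_measurable M. \<forall>\<omega>\<in>space M. f \<omega> \<in> Q \<omega>}"
  define N where "N f = (LINT \<omega>|M. (norm (f \<omega>))\<^sup>2)" for f :: "'a \<Rightarrow> 'b"
  define C where "C n = {f \<in> S. norm ((LINT \<omega>|M. f \<omega>) - y) \<le> \<eta> n}" for n
  define d where "d n = Inf (N ` C n)" for n
  have meas: "f \<in> borel_measurable M" if "f \<in> S" for f
    using that by (simp add: S_def)
  have int: "integrable M f" if "f \<in> S" for f
    using that by (intro integrable_const_bound[where B = B]) (auto simp: S_def bound)
  have int2: "integrable M (\<lambda>\<omega>. (norm (f \<omega>))\<^sup>2)" if "f \<in> S" for f
    using that
    by (intro integrable_const_bound[where B = "B\<^sup>2"]) (auto simp: S_def bound intro!: power_mono)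
  have mid: "(\<lambda>\<omega>. (1/2) *\<^sub>R f \<omega> + (1/2) *\<^sub>R g \<omega>) \<in> S" if "f \<in> S" "g \<in> S" for f g
    using that convex by (auto simp: S_def intro!: convexD)
  have N_nonneg: "0 \<le> N f" for f
    by (simp add: N_def)
  have N_le: "N f \<le> B\<^sup>2" if "f \<in> S" for f
  proof -
    have "N f \<le> (LINT \<omega>|M. B\<^sup>2)"
      unfolding N_def using that
      by (intro integral_mono int2) (auto simp: S_def bound intro!: power_mono)
    then show ?thesis by (simp add: prob_space)
  qed
  have C_ne: "C n \<noteq> {}" for n
  proof -
    have "\<forall>\<^sub>F k in sequentially. dist (LINT \<omega>|M. h k \<omega>) y < \<eta> n"
      using lim \<eta>_pos by (rule tendstoD)
    then obtain k where "dist (LINT \<omega>|M. h k \<omega>) y < \<eta> n"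
      using eventually_happens by fastforce
    then have "h k \<in> C n"
      using h by (simp add: C_def S_def dist_norm)
    then show ?thesis by blast
  qed
  have C_S: "C n \<subseteq> S" for n
    by (auto simp: C_def)
  have C_mono: "C k \<subseteq> C n" if "n \<le> k" for n k
    using \<eta>_mono[OF that] by (auto simp: C_def)
  have bdd: "bdd_below (N ` C n)" for n
    using N_nonneg by (intro bdd_belowI[where m = 0]) auto
  have d_le: "d n \<le> N f" if "f \<in> C n" for n f
    unfolding d_def using that bdd by (intro cInf_lower) auto
  \<comment> \<open>The constraint sets \<open>C n\<close> shrink, so their minimal values increase;
    \<open>B\<^sup>2\<close> bounds them, and the limit \<open>D\<close> exists.\<close>
  have "incseq d"
    unfolding d_def by (intro incseq_SucI cInf_superset_mono bdd image_mono C_mono) (use C_ne in auto)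
  moreover have "d n \<le> B\<^sup>2" for n
    using C_ne[of n] d_le N_le C_S by (meson all_not_in_conv order_trans subsetD)
  ultimately obtain D where D: "d \<longlonglongrightarrow> D" "\<And>n. d n \<le> D"
    using incseq_convergent[of d "B\<^sup>2"] by blast
  have "\<exists>f. f \<in> C n \<and> N f < d n + \<eta> n" for n
    using cInf_lessD[of "N ` C n" "d n + \<eta> n"] C_ne[of n]
    using \<eta>_pos[of n] by (auto simp: d_def)
  then obtain f where f: "\<And>n. f n \<in> C n" "\<And>n. N (f n) < d n + \<eta> n"
    by metis
  have fS: "f n \<in> S" for n
    using f(1) C_S by blast
  \<comment> \<open>The midpoint of two members of \<open>C n\<close> is again in
    \<open>C n\<close>, so its value is at least \<open>d n\<close>. With \<open>N (f i)\<close> and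
    \<open>N (f j)\<close> at most \<open>D + \<eta> n\<close>, the parallelogram law leaves
    \<open>4 * (D + \<eta> n) - 4 * d n\<close>.\<close>
  have diff: "N (\<lambda>\<omega>. f i \<omega> - f j \<omega>) \<le> 4 * (D - d n) + 4 * \<eta> n"
    if "n \<le> i" "n \<le> j" for n i j
  proof -
    define m where "m \<omega> = (1/2) *\<^sub>R f i \<omega> + (1/2) *\<^sub>R f j \<omega>" for \<omega>
    have mS: "m \<in> S"
      using mid[OF fS fS, of i j] by (simp add: m_def[abs_def])
    have "f i \<in> C n" "f j \<in> C n"
      using f(1) C_mono that by blast+
    then have near: "norm ((LINT \<omega>|M. f i \<omega>) - y) \<le> \<eta> n"
      "norm ((LINT \<omega>|M. f j \<omega>) - y) \<le> \<eta> n"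
      by (auto simp: C_def)
    have "(LINT \<omega>|M. m \<omega>) - y =
        (1/2) *\<^sub>R ((LINT \<omega>|M. f i \<omega>) - y) + (1/2) *\<^sub>R ((LINT \<omega>|M. f j \<omega>) - y)"
      unfolding m_def using int fS by (simp add: algebra_simps flip: scaleR_add_left)
    also have "norm \<dots> \<le> (1/2) * norm ((LINT \<omega>|M. f i \<omega>) - y) + (1/2) * norm ((LINT \<omega>|M. f j \<omega>) - y)"
      by (rule norm_triangle_le) simp
    finally have "m \<in> C n"
      using near mS by (simp add: C_def)
    then have "d n \<le> N m"
      by (rule d_le)
    moreover have "N (\<lambda>\<omega>. f i \<omega> - f j \<omega>) = 2 * N (f i) + 2 * N (f j) - 4 * N m"
      unfolding N_def norm_diff_square_parallelogram m_def[symmetric]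
      using int2[OF fS] int2[OF mS] by simp
    moreover have "N (f i) \<le> D + \<eta> n" "N (f j) \<le> D + \<eta> n"
    proof -
      have "N (f k) \<le> D + \<eta> n" if "n \<le> k" for k
        using \<eta>_mono[OF that] f(2)[of k] D(2)[of k] by linarith
      then show "N (f i) \<le> D + \<eta> n" "N (f j) \<le> D + \<eta> n"
        using that by auto
    qed
    ultimately show ?thesis by argo
  qed
  have "(\<lambda>n. 4 * (D - d n) + 4 * \<eta> n) \<longlonglongrightarrow> 4 * (D - D) + 4 * 0"
    by (intro tendsto_intros D \<eta>_lim)
  then have small: "\<forall>\<^sub>F n in sequentially. 4 * (D - d n) + 4 * \<eta> n < \<epsilon>" if "0 < \<epsilon>" for \<epsilon>
    using that by (intro order_tendstoD) auto
  have "\<exists>n. \<forall>i\<ge>n. \<forall>j\<ge>n. (LINT \<omega>|M. norm (f i \<omega> - f j \<omega>)) < \<delta>" if pos: "0 < \<delta>" for \<delta>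
  proof -
    obtain n where n: "4 * (D - d n) + 4 * \<eta> n < \<delta>\<^sup>2"
      using eventually_happens[OF small[of "\<delta>\<^sup>2"]] pos by (metis sequentially_bot zero_less_power)
    have "(LINT \<omega>|M. norm (f i \<omega> - f j \<omega>)) < \<delta>" if "n \<le> i" "n \<le> j" for i j
    proof (rule integral_norm_le_square[where C = "2 * B"])
      show "(\<lambda>\<omega>. f i \<omega> - f j \<omega>) \<in> borel_measurable M"
        using meas[OF fS] by measurable
      show "norm (f i \<omega> - f j \<omega>) \<le> 2 * B" if "\<omega> \<in> space M" for \<omega>
      proof -
        have "norm (f k \<omega>) \<le> B" for k
          using fS[of k] that by (intro bound) (auto simp: S_def)
        from this[of i] this[of j] show ?thesis
          using norm_triangle_ineq4[of "f i \<omega>" "f j \<omega>"] by linarith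
      qed
      show "(LINT \<omega>|M. (norm (f i \<omega> - f j \<omega>))\<^sup>2) < \<delta>\<^sup>2"
        using diff[OF that] n by (simp add: N_def)
    qed fact
    then show ?thesis by blast
  qed
  then obtain r where r: "strict_mono r" "AE \<omega> in M. Cauchy (\<lambda>i. f (r i) \<omega>)"
    using cauchy_L1_AE_cauchy_subseq[of M f] int[OF fS] by blast
  \<comment> \<open>The default \<open>f 0 \<omega>\<close> on the exceptional null set makes
    \<open>F\<close> a selection at every point, not only almost everywhere.\<close>
  define F where "F \<omega> = (if Cauchy (\<lambda>i. f (r i) \<omega>) then lim (\<lambda>i. f (r i) \<omega>) else f 0 \<omega>)" for \<omega>
  have [measurable]: "f n \<in> borel_measurable M" for n
    by (rule meas[OF fS])
  have F_meas: "F \<in> borel_measurable M"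
    unfolding F_def by measurable
  have F_lim: "(\<lambda>i. f (r i) \<omega>) \<longlonglongrightarrow> F \<omega>" if "Cauchy (\<lambda>i. f (r i) \<omega>)" for \<omega>
    using that by (simp add: F_def Cauchy_convergent_iff convergent_LIMSEQ_iff)
  have F_Q: "F \<omega> \<in> Q \<omega>" if "\<omega> \<in> space M" for \<omega>
  proof (cases "Cauchy (\<lambda>i. f (r i) \<omega>)")
    case True
    show ?thesis
      by (rule closed_sequentially[OF closed[OF that] _ F_lim[OF True]])
        (use fS that in \<open>simp add: S_def\<close>)
  next
    case False
    then show ?thesis
      using fS[of 0] that by (simp add: F_def S_def)
  qed
  have "(\<lambda>i. LINT \<omega>|M. f (r i) \<omega>) \<longlonglongrightarrow> (LINT \<omega>|M. F \<omega>)"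
  proof (rule integral_dominated_convergence[where w = "\<lambda>_. B"])
    show "AE \<omega> in M. (\<lambda>i. f (r i) \<omega>) \<longlonglongrightarrow> F \<omega>"
      using r(2) F_lim by auto
    show "AE \<omega> in M. norm (f (r i) \<omega>) \<le> B" for i
      using fS bound by (auto simp: S_def)
  qed (use F_meas in auto)
  moreover have "(\<lambda>i. LINT \<omega>|M. f (r i) \<omega>) \<longlonglongrightarrow> y"
  proof -
    have "(\<lambda>i. (LINT \<omega>|M. f i \<omega>) - y) \<longlonglongrightarrow> 0"
      by (rule Lim_null_comparison[OF _ \<eta>_lim])
        (use f(1) in \<open>auto simp: C_def\<close>)
    then show ?thesis
      using r(1) LIMSEQ_subseq_LIMSEQ[of "\<lambda>i. LINT \<omega>|M. f i \<omega>" y r]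
      by (simp add: LIM_zero_cancel o_def)
  qed
  ultimately have "(LINT \<omega>|M. F \<omega>) = y"
    using LIMSEQ_unique by blast
  then show ?thesis
    using F_meas F_Q by blast
qed

section \<open>Minimizers depending on a parameter\<close>

text \<open>The parameter will consist of a contract, a mean effort and the characteristics of a
  type; \<open>F\<close> will be a certainty equivalent and \<open>E\<close> the maximal
  effort.\<close>

locale parametric_minimization =
  fixes F :: "'x::heine_borel \<Rightarrow> real \<Rightarrow> real" and E :: real
  assumes cont: "continuous_on UNIV (\<lambda>(\<xi>, e). F \<xi> e)"
    and E_nonneg: "0 \<le> E"
begin

definition minimizers :: "'x \<Rightarrow> real set" where
  "minimizers \<xi> = {e \<in> {0..E}. \<forall>e'\<in>{0..E}. F \<xi> e \<le> F \<xi> e'}"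

definition lo :: "'x \<Rightarrow> real" where "lo \<xi> = Inf (minimizers \<xi>)"
definition hi :: "'x \<Rightarrow> real" where "hi \<xi> = Sup (minimizers \<xi>)"

lemma F_tendsto:
  assumes "X \<longlonglongrightarrow> \<xi>" "Y \<longlonglongrightarrow> e"
  shows "(\<lambda>n. F (X n) (Y n)) \<longlonglongrightarrow> F \<xi> e"
  using continuous_on_tendsto_compose[OF cont tendsto_Pair[OF assms]] by simp

text \<open>The inequality against each fixed competitor passes to the limit, so the graph of the
  minimizers is closed.\<close>

lemma minimizers_limit:
  assumes "X \<longlonglongrightarrow> \<xi>" "Y \<longlonglongrightarrow> e" "\<And>n. Y n \<in> minimizers (X n)"
  shows "e \<in> minimizers \<xi>"
proof -
  have Y: "Y n \<in> {0..E}" "\<And>e'. e' \<in> {0..E} \<Longrightarrow> F (X n) (Y n) \<le> F (X n) e'" for n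
    using assms(3)[of n] by (simp_all add: minimizers_def)
  have "e \<in> {0..E}"
    using closed_sequentially[OF closed_atLeastAtMost Y(1) assms(2)] .
  moreover have "F \<xi> e \<le> F \<xi> e'" if "e' \<in> {0..E}" for e'
    using LIMSEQ_le[OF F_tendsto[OF assms(1,2)] F_tendsto[OF assms(1) tendsto_const]] Y(2)[OF that]
    by blast
  ultimately show ?thesis by (simp add: minimizers_def)
qed

lemma minimizers_nonempty: "minimizers \<xi> \<noteq> {}"
proof -
  have "continuous_on {0..E} (F \<xi>)"
    by (rule continuous_on_compose2[OF cont, of _ "\<lambda>e. (\<xi>, e)", simplified])
      (auto intro!: continuous_intros)
  then obtain e where "e \<in> {0..E}" "\<forall>e'\<in>{0..E}. F \<xi> e \<le> F \<xi> e'"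
    using continuous_attains_inf[of "{0..E}" "F \<xi>"] E_nonneg by auto
  then show ?thesis by (auto simp: minimizers_def)
qed

lemma minimizers_bounds: "e \<in> minimizers \<xi> \<Longrightarrow> 0 \<le> e \<and> e \<le> E"
  by (simp add: minimizers_def)

lemma minimizers_value: "e \<in> minimizers \<xi> \<Longrightarrow> e' \<in> minimizers \<xi> \<Longrightarrow> F \<xi> e = F \<xi> e'"
  by (intro antisym) (simp_all add: minimizers_def)

lemma closed_minimizers: "closed (minimizers \<xi>)"
  unfolding closed_sequential_limits using minimizers_limit[OF tendsto_const] by blast

lemma compact_minimizers: "compact (minimizers \<xi>)"
proof -
  have "minimizers \<xi> = {0..E} \<inter> minimizers \<xi>"
    by (auto simp: minimizers_def)
  then show ?thesis
    using compact_Int_closed[OF compact_Icc closed_minimizers] by metis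
qed

lemma lo_in: "lo \<xi> \<in> minimizers \<xi>"
  unfolding lo_def
  by (intro closed_contains_Inf minimizers_nonempty closed_minimizers bdd_belowI[of _ 0])
    (simp add: minimizers_def)

lemma hi_in: "hi \<xi> \<in> minimizers \<xi>"
  unfolding hi_def
  by (intro closed_contains_Sup minimizers_nonempty closed_minimizers bdd_aboveI[of _ E])
    (simp add: minimizers_def)

lemma lo_le: "e \<in> minimizers \<xi> \<Longrightarrow> lo \<xi> \<le> e"
  unfolding lo_def by (rule cInf_lower) (auto intro!: bdd_belowI[of _ 0] simp: minimizers_def)

lemma le_hi: "e \<in> minimizers \<xi> \<Longrightarrow> e \<le> hi \<xi>"
  unfolding hi_def by (rule cSup_upper) (auto intro!: bdd_aboveI[of _ E] simp: minimizers_def)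

lemma minimizers_eq:
  assumes "convex (minimizers \<xi>)"
  shows "minimizers \<xi> = {lo \<xi>..hi \<xi>}"
proof
  show "minimizers \<xi> \<subseteq> {lo \<xi>..hi \<xi>}"
    using lo_le le_hi by auto
  have "is_interval (minimizers \<xi>)"
    using assms by (simp add: is_interval_convex_1)
  from mem_is_interval_1_I[OF this lo_in hi_in] show "{lo \<xi>..hi \<xi>} \<subseteq> minimizers \<xi>"
    by auto
qed

lemma minimizers_subseq:
  assumes "X \<longlonglongrightarrow> \<xi>" "\<And>n. Y n \<in> minimizers (X n)"
  obtains r e where "strict_mono r" "(Y \<circ> r) \<longlonglongrightarrow> e" "e \<in> minimizers \<xi>"
proof -
  have "\<forall>n. Y n \<in> {0..E}"
    using assms(2) by (simp add: minimizers_def)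
  then obtain r e where r: "strict_mono r" "(Y \<circ> r) \<longlonglongrightarrow> e"
    using compact_Icc[of 0 E] unfolding compact_def by metis
  moreover have "e \<in> minimizers \<xi>"
    by (rule minimizers_limit[OF LIMSEQ_subseq_LIMSEQ[OF assms(1) r(1)] r(2)]) (simp add: assms)
  ultimately show ?thesis using that by blast
qed

text \<open>A limit of smallest minimizers is a minimizer, though perhaps not the smallest, so in
  the limit \<open>lo\<close> can only drop. This lower semicontinuity is the source of the Borel
  measurability of \<open>lo\<close>; the case of \<open>hi\<close> is symmetric.\<close>

lemma closed_lo_le: "closed {\<xi>. lo \<xi> \<le> t}"
  unfolding closed_sequential_limits
proof safe
  fix X \<xi>
  assume X: "\<forall>n. X n \<in> {\<xi>. lo \<xi> \<le> t}" "X \<longlonglongrightarrow> \<xi>"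
  obtain r e where r: "((\<lambda>n. lo (X n)) \<circ> r) \<longlonglongrightarrow> e" "e \<in> minimizers \<xi>"
    using minimizers_subseq[OF X(2), of "\<lambda>n. lo (X n)", OF lo_in] by blast
  have "e \<le> t"
    by (rule LIMSEQ_le_const2[OF r(1)]) (use X(1) in auto)
  then show "lo \<xi> \<le> t"
    using lo_le[OF r(2)] by simp
qed

lemma closed_hi_ge: "closed {\<xi>. t \<le> hi \<xi>}"
  unfolding closed_sequential_limits
proof safe
  fix X \<xi>
  assume X: "\<forall>n. X n \<in> {\<xi>. t \<le> hi \<xi>}" "X \<longlonglongrightarrow> \<xi>"
  obtain r e where r: "((\<lambda>n. hi (X n)) \<circ> r) \<longlonglongrightarrow> e" "e \<in> minimizers \<xi>"
    using minimizers_subseq[OF X(2), of "\<lambda>n. hi (X n)", OF hi_in] by blast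
  have "t \<le> e"
    by (rule LIMSEQ_le_const[OF r(1)]) (use X(1) in auto)
  then show "t \<le> hi \<xi>"
    using le_hi[OF r(2)] by simp
qed

lemma lo_borel[measurable]: "lo \<in> borel_measurable borel"
  by (rule borel_measurableI_le) (auto intro: borel_closed closed_lo_le)

lemma hi_borel[measurable]: "hi \<in> borel_measurable borel"
  by (rule borel_measurableI_ge) (auto intro: borel_closed closed_hi_ge)

text \<open>Clamping to \<open>[lo \<xi>, hi \<xi>]\<close>, which is the nearest minimizer when the
  minimizers form an interval. Being a formula in \<open>lo\<close> and \<open>hi\<close>, it
  preserves measurability when applied along a selection.\<close>

definition proj :: "'x \<Rightarrow> real \<Rightarrow> real" where
  "proj \<xi> e = max (lo \<xi>) (min (hi \<xi>) e)"

lemma proj_in: "convex (minimizers \<xi>) \<Longrightarrow> proj \<xi> e \<in> minimizers \<xi>"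
  using le_hi[OF lo_in[of \<xi>]] by (simp add: minimizers_eq proj_def)

lemma proj_bounds: "0 \<le> proj \<xi> e \<and> proj \<xi> e \<le> E"
  using minimizers_bounds[OF lo_in[of \<xi>]] minimizers_bounds[OF hi_in[of \<xi>]]
  by (auto simp: proj_def max_def min_def)

text \<open>By semicontinuity of \<open>lo\<close> and \<open>hi\<close>, the minimizers at
  \<open>X n\<close> eventually lie between \<open>lo \<xi> - \<epsilon>\<close> and
  \<open>hi \<xi> + \<epsilon>\<close>, and clamping moves such points by less than
  \<open>\<epsilon>\<close>. No convergence of \<open>Y\<close> itself is involved.\<close>

lemma minimizers_proj_tendsto:
  assumes "X \<longlonglongrightarrow> \<xi>" "\<And>n. Y n \<in> minimizers (X n)"
  shows "(\<lambda>n. Y n - proj \<xi> (Y n)) \<longlonglongrightarrow> 0"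
proof (rule tendstoI)
  fix \<epsilon> :: real assume "0 < \<epsilon>"
  have "\<forall>\<^sub>F n in sequentially. X n \<in> - {\<xi>'. lo \<xi>' \<le> lo \<xi> - \<epsilon>}"
    using \<open>0 < \<epsilon>\<close> by (intro topological_tendstoD[OF assms(1)] open_Compl closed_lo_le) simp
  moreover have "\<forall>\<^sub>F n in sequentially. X n \<in> - {\<xi>'. hi \<xi> + \<epsilon> \<le> hi \<xi>'}"
    using \<open>0 < \<epsilon>\<close> by (intro topological_tendstoD[OF assms(1)] open_Compl closed_hi_ge) simp
  ultimately show "\<forall>\<^sub>F n in sequentially. dist (Y n - proj \<xi> (Y n)) 0 < \<epsilon>"
  proof eventually_elim
    case (elim n)
    have "lo (X n) \<le> Y n" "Y n \<le> hi (X n)"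
      using assms(2) lo_le le_hi by auto
    moreover have "lo \<xi> \<le> hi \<xi>"
      using le_hi lo_in by blast
    ultimately show ?case
      using elim \<open>0 < \<epsilon>\<close> by (auto simp: proj_def dist_real_def max_def min_def)
  qed
qed

lemma convex_minimizers:
  assumes "convex_on {0..E} (F \<xi>)"
  shows "convex (minimizers \<xi>)"
proof (rule convexI)
  fix a b u v :: real
  assume a: "a \<in> minimizers \<xi>" and b: "b \<in> minimizers \<xi>" and uv: "0 \<le> u" "0 \<le> v" "u + v = 1"
  have ab: "a \<in> {0..E}" "b \<in> {0..E}"
    using a b by (auto simp: minimizers_def)
  have mem: "u *\<^sub>R a + v *\<^sub>R b \<in> {0..E}"
    using convexD[OF convex_real_interval(5) ab uv] .
  moreover have "F \<xi> (u *\<^sub>R a + v *\<^sub>R b) \<le> u * F \<xi> a + v * F \<xi> b"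
    using convex_onD[OF assms, of v a b] ab uv by (simp add: eq_diff_eq[symmetric])
  moreover have "u * F \<xi> a + v * F \<xi> b = F \<xi> a"
    using minimizers_value[OF b a] uv(3) by (simp flip: distrib_right)
  ultimately show "u *\<^sub>R a + v *\<^sub>R b \<in> minimizers \<xi>"
    using a by (auto simp: minimizers_def intro: order_trans)
qed

text \<open>A sum of convex functions that is constant on a segment has affine summands there.\<close>

lemma minimizers_affine_summand:
  assumes \<phi>: "convex_on {0..E} \<phi>" and \<rho>: "convex_on {0..E} \<rho>" and w: "0 < w"
    and F: "\<And>e. e \<in> {0..E} \<Longrightarrow> F \<xi> e = w * \<phi> e + \<rho> e"
    and a: "a \<in> minimizers \<xi>" and b: "b \<in> minimizers \<xi>" and t: "0 \<le> t" "t \<le> 1"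
  shows "\<phi> ((1 - t) * a + t * b) = (1 - t) * \<phi> a + t * \<phi> b"
proof -
  let ?d = "(1 - t) * a + t * b"
  have ab: "a \<in> {0..E}" "b \<in> {0..E}"
    using a b by (auto simp: minimizers_def)
  have d: "?d \<in> {0..E}"
    using convexD[OF convex_real_interval(5) ab, of "1 - t" t] t by simp
  \<comment> \<open>Minimality of the common value, tested at \<open>?d\<close>, combined with
    convexity of \<open>\<rho>\<close> forces the reverse of the convexity inequality for
    \<open>\<phi>\<close> once \<open>w\<close> is cancelled.\<close>
  have "w * ((1 - t) * \<phi> a + t * \<phi> b) + ((1 - t) * \<rho> a + t * \<rho> b)
      = (1 - t) * F \<xi> a + t * F \<xi> b"
    unfolding F[OF ab(1)] F[OF ab(2)] by (simp add: algebra_simps)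
  also have "\<dots> = F \<xi> a"
    using minimizers_value[OF b a] by (simp add: algebra_simps)
  also have "\<dots> \<le> F \<xi> ?d"
    using a d by (simp add: minimizers_def)
  also have "\<dots> = w * \<phi> ?d + \<rho> ?d"
    by (rule F[OF d])
  also have "\<dots> \<le> w * \<phi> ?d + ((1 - t) * \<rho> a + t * \<rho> b)"
    using convex_onD[OF \<rho> t ab] by simp
  finally have "(1 - t) * \<phi> a + t * \<phi> b \<le> \<phi> ?d"
    using w by simp
  moreover have "\<phi> ?d \<le> (1 - t) * \<phi> a + t * \<phi> b"
    using convex_onD[OF \<phi> t ab] by simp
  ultimately show ?thesis by simp
qed

end

section \<open>Outcomes of a single type\<close>

locale opt_in_choice =
  ins: parametric_minimization F E + out: parametric_minimization G E
  for F G :: "'x::heine_borel \<Rightarrow> real \<Rightarrow> real" and E :: real +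
  fixes g :: "'x \<Rightarrow> real \<Rightarrow> real"
  assumes cont_g: "continuous_on UNIV (\<lambda>(\<xi>, e). g \<xi> e)"
begin

text \<open>\<open>lo\<close> merely names some minimizer: all minimizers share one value, so the
  comparison is between the two minimal certainty equivalents.\<close>

definition prefer_in :: "'x set" where "prefer_in = {\<xi>. F \<xi> (ins.lo \<xi>) < G \<xi> (out.lo \<xi>)}"
definition prefer_out :: "'x set" where "prefer_out = {\<xi>. G \<xi> (out.lo \<xi>) < F \<xi> (ins.lo \<xi>)}"

definition opt_in :: "'x \<Rightarrow> real set" where
  "opt_in \<xi> = {q \<in> {0..1}. (\<xi> \<in> prefer_in \<longrightarrow> q = 1) \<and> (\<xi> \<in> prefer_out \<longrightarrow> q = 0)}"

definition feasible :: "'x \<Rightarrow> (real \<times> real \<times> real) set" where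
  "feasible \<xi> = opt_in \<xi> \<times> ins.minimizers \<xi> \<times> out.minimizers \<xi>"

text \<open>Weighting the two efforts by \<open>q\<close> and \<open>1 - q\<close> makes the set of outcomes convex.\<close>

definition outcome :: "'x \<Rightarrow> real \<times> real \<times> real \<Rightarrow> real \<times> real \<times> real \<times> real" where
  "outcome \<xi> = (\<lambda>(q, e, e'). (q, q * e, (1 - q) * e', q * g \<xi> e))"

text \<open>Stated for two abstract objectives because it is applied in both orders, to the insured
  against the uninsured and conversely.\<close>

lemma closed_not_prefer:
  assumes "parametric_minimization F1 E" "parametric_minimization F2 E"
  shows "closed {\<xi>. F1 \<xi> (parametric_minimization.lo F1 E \<xi>) \<le> F2 \<xi> (parametric_minimization.lo F2 E \<xi>)}"
  unfolding closed_sequential_limits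
proof safe
  interpret a: parametric_minimization F1 E by fact
  interpret b: parametric_minimization F2 E by fact
  fix X \<xi>
  assume X: "\<forall>n. X n \<in> {\<xi>. F1 \<xi> (a.lo \<xi>) \<le> F2 \<xi> (b.lo \<xi>)}" "X \<longlonglongrightarrow> \<xi>"
  obtain r e where r: "strict_mono r" "((\<lambda>n. a.lo (X n)) \<circ> r) \<longlonglongrightarrow> e" "e \<in> a.minimizers \<xi>"
    using a.minimizers_subseq[OF X(2), of "\<lambda>n. a.lo (X n)", OF a.lo_in] by blast
  note Xr = LIMSEQ_subseq_LIMSEQ[OF X(2) r(1)]
  \<comment> \<open>The right-hand minimizer at \<open>X n\<close> is replaced by the fixed
    competitor \<open>b.lo \<xi>\<close>, so only the left-hand minimizers need a convergent
    subsequence.\<close>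
  have "F1 \<xi> e \<le> F2 \<xi> (b.lo \<xi>)"
  proof (rule LIMSEQ_le[OF a.F_tendsto[OF Xr r(2)] b.F_tendsto[OF Xr tendsto_const]])
    have "F1 (X n) (a.lo (X n)) \<le> F2 (X n) (b.lo \<xi>)" for n
    proof -
      have "F1 (X n) (a.lo (X n)) \<le> F2 (X n) (b.lo (X n))"
        using X(1) by simp
      also have "\<dots> \<le> F2 (X n) (b.lo \<xi>)"
        using b.lo_in[of "X n"] b.lo_in[of \<xi>] by (auto simp: b.minimizers_def)
      finally show ?thesis .
    qed
    then show "\<exists>N. \<forall>n\<ge>N. F1 ((X \<circ> r) n) (((\<lambda>n. a.lo (X n)) \<circ> r) n) \<le> F2 ((X \<circ> r) n) (b.lo \<xi>)"
      by simp
  qed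
  then show "F1 \<xi> (a.lo \<xi>) \<le> F2 \<xi> (b.lo \<xi>)"
    using a.minimizers_value[OF a.lo_in r(3)] by simp
qed

lemma open_prefer_in: "open prefer_in"
proof -
  have "prefer_in = - {\<xi>. G \<xi> (out.lo \<xi>) \<le> F \<xi> (ins.lo \<xi>)}"
    by (auto simp: prefer_in_def)
  then show ?thesis
    using closed_not_prefer[OF out.parametric_minimization_axioms ins.parametric_minimization_axioms]
    by (simp add: open_Compl)
qed

lemma open_prefer_out: "open prefer_out"
proof -
  have "prefer_out = - {\<xi>. F \<xi> (ins.lo \<xi>) \<le> G \<xi> (out.lo \<xi>)}"
    by (auto simp: prefer_out_def)
  then show ?thesis
    using closed_not_prefer[OF ins.parametric_minimization_axioms out.parametric_minimization_axioms]
    by (simp add: open_Compl)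
qed

lemma not_prefer_both: "\<xi> \<in> prefer_in \<Longrightarrow> \<xi> \<notin> prefer_out"
  by (simp add: prefer_in_def prefer_out_def)

text \<open>Since the value does not depend on the minimizer, the test at \<open>lo\<close> agrees
  with the test at the chosen pair \<open>e\<close>, \<open>e'\<close>, which is how equilibria
  phrase it.\<close>

lemma feasible_iff:
  "(q, e, e') \<in> feasible \<xi> \<longleftrightarrow>
     e \<in> ins.minimizers \<xi> \<and> e' \<in> out.minimizers \<xi> \<and> q \<in> {0..1} \<and>
     (F \<xi> e < G \<xi> e' \<longrightarrow> q = 1) \<and> (G \<xi> e' < F \<xi> e \<longrightarrow> q = 0)"
proof (cases "e \<in> ins.minimizers \<xi> \<and> e' \<in> out.minimizers \<xi>")
  case True
  then have "F \<xi> (ins.lo \<xi>) = F \<xi> e" "G \<xi> (out.lo \<xi>) = G \<xi> e'"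
    using ins.minimizers_value[OF ins.lo_in] out.minimizers_value[OF out.lo_in] by blast+
  then show ?thesis
    using True by (auto simp: feasible_def opt_in_def prefer_in_def prefer_out_def)
qed (simp add: feasible_def, blast)

lemma convex_opt_in: "convex (opt_in \<xi>)" and compact_opt_in: "compact (opt_in \<xi>)"
proof -
  consider "opt_in \<xi> = {1}" | "opt_in \<xi> = {0}" | "opt_in \<xi> = {0..1}"
    using not_prefer_both[of \<xi>] by (fastforce simp: opt_in_def)
  then have "convex (opt_in \<xi>) \<and> compact (opt_in \<xi>)"
    by cases auto
  then show "convex (opt_in \<xi>)" "compact (opt_in \<xi>)" by auto
qed

lemma continuous_on_g: "continuous_on S (g \<xi>)"
  by (rule continuous_on_compose2[OF cont_g, of _ "\<lambda>e. (\<xi>, e)", simplified])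
    (auto intro!: continuous_intros)

lemma compact_outcomes: "compact (outcome \<xi> ` feasible \<xi>)"
  unfolding feasible_def
  by (intro compact_continuous_image compact_Times compact_opt_in ins.compact_minimizers
      out.compact_minimizers)
    (unfold outcome_def case_prod_unfold,
      intro continuous_intros continuous_on_compose2[OF continuous_on_g[of UNIV]], simp)

text \<open>Averaging two outcomes averages the probabilities, while the insured efforts mix with
  weights proportional to \<open>u * q1\<close> and \<open>v * q2\<close>, and the uninsured efforts
  with weights proportional to \<open>u * (1 - q1)\<close> and \<open>v * (1 - q2)\<close>. Affinity
  of \<open>g\<close> along the insured minimizers makes the last coordinate follow the same
  mixture.\<close>

lemma convex_outcomes:
  assumes "convex (ins.minimizers \<xi>)" "convex (out.minimizers \<xi>)"
    and affine: "\<And>a b t. a \<in> ins.minimizers \<xi> \<Longrightarrow> b \<in> ins.minimizers \<xi> \<Longrightarrow> 0 \<le> t \<Longrightarrow> t \<le> 1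
      \<Longrightarrow> g \<xi> ((1 - t) * a + t * b) = (1 - t) * g \<xi> a + t * g \<xi> b"
  shows "convex (outcome \<xi> ` feasible \<xi>)"
proof -
  \<comment> \<open>The normalised weights \<open>1 - t\<close> and \<open>t\<close>. If the total
    weight vanishes, both summands are zero and any \<open>t\<close> works.\<close>
  have mix: "\<exists>t. 0 \<le> t \<and> t \<le> 1 \<and> u * q1 = (u * q1 + v * q2) * (1 - t) \<and> v * q2 = (u * q1 + v * q2) * t"
    if "0 \<le> u" "0 \<le> v" "0 \<le> q1" "0 \<le> q2" for u v q1 q2 :: real
  proof (cases "u * q1 + v * q2 = 0")
    case True
    then have "u * q1 = 0" "v * q2 = 0"
      using that by (simp_all add: add_nonneg_eq_0_iff)
    then show ?thesis by (intro exI[of _ 0]) auto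
  next
    case False
    then have "0 < u * q1 + v * q2"
      using that by (simp add: order_less_le)
    then show ?thesis
      using that by (intro exI[of _ "v * q2 / (u * q1 + v * q2)"]) (auto simp: field_simps)
  qed
  show ?thesis
  proof (rule convexI)
    fix y1 y2 and u v :: real
    assume "y1 \<in> outcome \<xi> ` feasible \<xi>" "y2 \<in> outcome \<xi> ` feasible \<xi>"
      and uv: "0 \<le> u" "0 \<le> v" "u + v = 1"
    then obtain q1 a1 b1 q2 a2 b2 where y: "y1 = outcome \<xi> (q1, a1, b1)" "y2 = outcome \<xi> (q2, a2, b2)"
      and q: "q1 \<in> opt_in \<xi>" "q2 \<in> opt_in \<xi>"
      and a: "a1 \<in> ins.minimizers \<xi>" "a2 \<in> ins.minimizers \<xi>"
      and b: "b1 \<in> out.minimizers \<xi>" "b2 \<in> out.minimizers \<xi>"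
      by (auto simp: feasible_def)
    have q01: "0 \<le> q1" "0 \<le> q2" "0 \<le> 1 - q1" "0 \<le> 1 - q2"
      using q by (auto simp: opt_in_def)
    define q where "q = u * q1 + v * q2"
    have q_compl: "u * (1 - q1) + v * (1 - q2) = 1 - q"
      using uv(3) by (simp add: q_def algebra_simps)
    obtain t where t: "0 \<le> t" "t \<le> 1" "u * q1 = q * (1 - t)" "v * q2 = q * t"
      using mix[of u v q1 q2] uv q01 unfolding q_def by metis
    obtain s where s: "0 \<le> s" "s \<le> 1" "u * (1 - q1) = (1 - q) * (1 - s)" "v * (1 - q2) = (1 - q) * s"
      using mix[of u v "1 - q1" "1 - q2"] uv q01 unfolding q_compl by metis
    define a where "a = (1 - t) * a1 + t * a2"
    define b where "b = (1 - s) * b1 + s * b2"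
    have "(q, a, b) \<in> feasible \<xi>"
      using convexD[OF convex_opt_in q uv] convexD[OF assms(1) \<open>a1 \<in> _\<close> \<open>a2 \<in> _\<close>, of "1 - t" t]
        convexD[OF assms(2) \<open>b1 \<in> _\<close> \<open>b2 \<in> _\<close>, of "1 - s" s] t(1,2) s(1,2)
      by (simp add: feasible_def q_def a_def b_def)
    moreover have "u *\<^sub>R y1 + v *\<^sub>R y2 = outcome \<xi> (q, a, b)"
    proof -
      have "u * (q1 * a1) + v * (q2 * a2) = q * a"
        unfolding a_def by (simp add: distrib_left t(3,4) flip: mult.assoc)
      moreover have "u * ((1 - q1) * b1) + v * ((1 - q2) * b2) = (1 - q) * b"
        unfolding b_def by (simp add: distrib_left s(3,4) flip: mult.assoc)
      moreover have "u * (q1 * g \<xi> a1) + v * (q2 * g \<xi> a2) = q * g \<xi> a"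
        unfolding a_def affine[OF \<open>a1 \<in> _\<close> \<open>a2 \<in> _\<close> t(1,2)]
        by (simp add: distrib_left t(3,4) flip: mult.assoc)
      ultimately show ?thesis
        by (simp add: y outcome_def q_def)
    qed
    ultimately show "u *\<^sub>R y1 + v *\<^sub>R y2 \<in> outcome \<xi> ` feasible \<xi>" by blast
  qed
qed

text \<open>Moves a triple feasible at a nearby parameter to one feasible at \<open>\<xi>\<close>. A
  strict preference at \<open>\<xi>\<close> dictates \<open>q\<close>; under indifference every
  value in \<open>[0, 1]\<close> is allowed and \<open>q\<close> is kept.\<close>

definition feasible_proj :: "'x \<Rightarrow> real \<times> real \<times> real \<Rightarrow> real \<times> real \<times> real" where
  "feasible_proj \<xi> = (\<lambda>(q, e, e').
     (if \<xi> \<in> prefer_in then 1 else if \<xi> \<in> prefer_out then 0 else q, ins.proj \<xi> e, out.proj \<xi> e'))"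

lemma feasible_proj_in:
  assumes "convex (ins.minimizers \<xi>)" "convex (out.minimizers \<xi>)" "0 \<le> fst s" "fst s \<le> 1"
  shows "feasible_proj \<xi> s \<in> feasible \<xi>"
  using assms not_prefer_both[of \<xi>]
  by (cases s) (simp add: feasible_proj_def feasible_def opt_in_def ins.proj_in out.proj_in)

text \<open>Strict preference is an open condition, so if it holds at \<open>\<xi>\<close> it
  eventually holds at \<open>X n\<close>, and \<open>q\<close> already has the forced value. The
  efforts are close to their clamped versions, and the weights \<open>q n\<close> and
  \<open>1 - q n\<close> are bounded by 1.\<close>

lemma outcome_proj_tendsto:
  assumes X: "X \<longlonglongrightarrow> \<xi>" and s: "\<And>n. s n \<in> feasible (X n)"
  shows "(\<lambda>n. outcome (X n) (s n) - outcome \<xi> (feasible_proj \<xi> (s n))) \<longlonglongrightarrow> 0"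
proof -
  define q e e' where "q n = fst (s n)" and "e n = fst (snd (s n))" and "e' n = snd (snd (s n))" for n
  define q' where "q' n = (if \<xi> \<in> prefer_in then 1 else if \<xi> \<in> prefer_out then 0 else q n)" for n
  have q: "q n \<in> opt_in (X n)" and e: "e n \<in> ins.minimizers (X n)" and e': "e' n \<in> out.minimizers (X n)" for n
    using s[of n] by (auto simp: feasible_def q_def e_def e'_def)
  have q01: "\<bar>q n\<bar> \<le> 1" "\<bar>1 - q n\<bar> \<le> 1" for n
    using q[of n] by (auto simp: opt_in_def)
  have bounds: "e n \<in> {0..E}" "ins.proj \<xi> (e n) \<in> {0..E}" "e' n \<in> {0..E}" "out.proj \<xi> (e' n) \<in> {0..E}" for n
    using ins.minimizers_bounds[OF e] out.minimizers_bounds[OF e'] ins.proj_bounds out.proj_bounds by auto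
  have "\<forall>\<^sub>F n in sequentially. q n = q' n"
  proof -
    consider "\<xi> \<in> prefer_in" | "\<xi> \<in> prefer_out" "\<xi> \<notin> prefer_in" | "\<xi> \<notin> prefer_in" "\<xi> \<notin> prefer_out"
      by blast
    then show ?thesis
    proof cases
      case 1
      then have "\<forall>\<^sub>F n in sequentially. X n \<in> prefer_in"
        using topological_tendstoD[OF X open_prefer_in] by blast
      then show ?thesis
        by eventually_elim (use q 1 in \<open>auto simp: opt_in_def q'_def\<close>)
    next
      case 2
      then have "\<forall>\<^sub>F n in sequentially. X n \<in> prefer_out"
        using topological_tendstoD[OF X open_prefer_out] by blast
      then show ?thesis
        by eventually_elim (use q 2 in \<open>auto simp: opt_in_def q'_def\<close>)
    qed (simp add: q'_def)
  qed
  moreover have "(\<lambda>n. g (X n) (e n) - g \<xi> (ins.proj \<xi> (e n))) \<longlonglongrightarrow> 0"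
  proof -
    \<comment> \<open>The efforts \<open>e n\<close> need not converge, so continuity at a point
      does not suffice; the parameters \<open>X n\<close> with their limit form a compact set, on
      which \<open>g\<close> is uniformly continuous.\<close>
    have "uniformly_continuous_on (insert \<xi> (range X) \<times> {0..E}) (\<lambda>(\<xi>, e). g \<xi> e)"
      by (intro compact_uniformly_continuous compact_Times compact_sequence_with_limit X compact_Icc
          continuous_on_subset[OF cont_g]) auto
    moreover have "(\<lambda>n. dist (X n, e n) (\<xi>, ins.proj \<xi> (e n))) \<longlonglongrightarrow> 0"
    proof -
      have "(\<lambda>n. sqrt ((dist (X n) \<xi>)\<^sup>2 + (norm (e n - ins.proj \<xi> (e n)))\<^sup>2)) \<longlonglongrightarrow> sqrt ((dist \<xi> \<xi>)\<^sup>2 + (norm (0::real))\<^sup>2)"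
        by (intro tendsto_intros X ins.minimizers_proj_tendsto[OF X] e)
      then show ?thesis by (simp add: dist_Pair_Pair dist_norm[of "e _"])
    qed
    ultimately have "(\<lambda>n. dist (g (X n) (e n)) (g \<xi> (ins.proj \<xi> (e n)))) \<longlonglongrightarrow> 0"
      unfolding uniformly_continuous_on_sequentially using bounds
      by (elim allE[of _ "\<lambda>n. (X n, e n)"] allE[of _ "\<lambda>n. (\<xi>, ins.proj \<xi> (e n))"]) simp
    then show ?thesis
      by (simp add: dist_real_def tendsto_rabs_zero_iff)
  qed
  moreover have "(\<lambda>n. e n - ins.proj \<xi> (e n)) \<longlonglongrightarrow> 0" "(\<lambda>n. e' n - out.proj \<xi> (e' n)) \<longlonglongrightarrow> 0"
    by (intro ins.minimizers_proj_tendsto[OF X] out.minimizers_proj_tendsto[OF X] e e')+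
  moreover have bounded_mult: "(\<lambda>n. c n * d n) \<longlonglongrightarrow> 0" if "\<And>n. \<bar>c n\<bar> \<le> 1" "d \<longlonglongrightarrow> 0" for c d :: "nat \<Rightarrow> real"
    by (rule Lim_null_comparison[OF always_eventually tendsto_rabs_zero[OF that(2)]])
      (use that(1) in \<open>auto simp: abs_mult mult_left_le_one_le\<close>)
  ultimately have "(\<lambda>n. (0, q n * (e n - ins.proj \<xi> (e n)), (1 - q n) * (e' n - out.proj \<xi> (e' n)),
      q n * (g (X n) (e n) - g \<xi> (ins.proj \<xi> (e n))))) \<longlonglongrightarrow> (0 :: real, 0, 0, 0)"
    using q01 by (intro tendsto_intros bounded_mult) auto
  then show ?thesis
    unfolding zero_prod_def
  proof (rule Lim_transform_eventually)
    show "\<forall>\<^sub>F n in sequentially.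
      (0, q n * (e n - ins.proj \<xi> (e n)), (1 - q n) * (e' n - out.proj \<xi> (e' n)),
        q n * (g (X n) (e n) - g \<xi> (ins.proj \<xi> (e n)))) =
      outcome (X n) (s n) - outcome \<xi> (feasible_proj \<xi> (s n))"
      using \<open>\<forall>\<^sub>F n in sequentially. q n = q' n\<close>
    proof eventually_elim
      case (elim n)
      have "s n = (q n, e n, e' n)"
        by (simp add: q_def e_def e'_def)
      moreover have "feasible_proj \<xi> (s n) = (q' n, ins.proj \<xi> (e n), out.proj \<xi> (e' n))"
        by (simp add: feasible_proj_def calculation q'_def)
      ultimately show ?case
        using elim by (simp add: outcome_def algebra_simps)
    qed
  qed
qed

end

section \<open>Aggregation over the types\<close>

text \<open>The parameter is split into \<open>z\<close>, common to all types and ranging over the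
  compact set \<open>Z\<close>, and the characteristics \<open>\<tau> \<theta>\<close>, which depend
  measurably on the type.\<close>

locale population = prob_space \<pi> + opt_in_choice F G E g
  for \<pi> :: "'t measure" and F G :: "'z::heine_borel \<times> 'p::euclidean_space \<Rightarrow> real \<Rightarrow> real"
    and E :: real and g :: "'z \<times> 'p \<Rightarrow> real \<Rightarrow> real" +
  fixes \<tau> :: "'t \<Rightarrow> 'p" and Z :: "'z set" and B :: real
  assumes type_measurable: "\<tau> \<in> borel_measurable \<pi>"
    and compact_Z: "compact Z"
    and convex_ins: "\<And>z \<theta>. z \<in> Z \<Longrightarrow> \<theta> \<in> space \<pi> \<Longrightarrow> convex (ins.minimizers (z, \<tau> \<theta>))"
    and convex_out: "\<And>z \<theta>. z \<in> Z \<Longrightarrow> \<theta> \<in> space \<pi> \<Longrightarrow> convex (out.minimizers (z, \<tau> \<theta>))"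
    and g_affine: "\<And>z \<theta> a b t. z \<in> Z \<Longrightarrow> \<theta> \<in> space \<pi> \<Longrightarrow> a \<in> ins.minimizers (z, \<tau> \<theta>)
      \<Longrightarrow> b \<in> ins.minimizers (z, \<tau> \<theta>) \<Longrightarrow> 0 \<le> t \<Longrightarrow> t \<le> 1
      \<Longrightarrow> g (z, \<tau> \<theta>) ((1 - t) * a + t * b) = (1 - t) * g (z, \<tau> \<theta>) a + t * g (z, \<tau> \<theta>) b"
    and g_bound: "\<And>z \<theta> e. z \<in> Z \<Longrightarrow> \<theta> \<in> space \<pi> \<Longrightarrow> e \<in> {0..E} \<Longrightarrow> \<bar>g (z, \<tau> \<theta>) e\<bar> \<le> B"
begin

definition selections :: "'z \<Rightarrow> ('t \<Rightarrow> real \<times> real \<times> real) set" where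
  "selections z = {s \<in> borel_measurable \<pi>. \<forall>\<theta>\<in>space \<pi>. s \<theta> \<in> feasible (z, \<tau> \<theta>)}"

text \<open>The coordinates are the insured share, the contributions of insured and of uninsured
  agents to the mean effort, and the integral of \<open>q * g\<close>. A mean effort is consistent
  when it equals the sum of the second and third.\<close>

definition aggregate :: "'z \<Rightarrow> ('t \<Rightarrow> real \<times> real \<times> real) \<Rightarrow> real \<times> real \<times> real \<times> real" where
  "aggregate z s = (LINT \<theta>|\<pi>. outcome (z, \<tau> \<theta>) (s \<theta>))"

lemma pair_measurable [measurable]: "(\<lambda>\<theta>. (z, \<tau> \<theta>)) \<in> borel_measurable \<pi>"
  by (rule measurable_compose[OF type_measurable borel_measurable_continuous_onI])
    (intro continuous_intros)

lemma prefer_measurable [measurable]: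
  "Measurable.pred \<pi> (\<lambda>\<theta>. (z, \<tau> \<theta>) \<in> prefer_in)" "Measurable.pred \<pi> (\<lambda>\<theta>. (z, \<tau> \<theta>) \<in> prefer_out)"
  by (rule pred_sets2[OF _ pair_measurable], simp add: open_prefer_in open_prefer_out)+

lemma outcome_measurable:
  assumes "s \<in> borel_measurable \<pi>"
  shows "(\<lambda>\<theta>. outcome (z, \<tau> \<theta>) (s \<theta>)) \<in> borel_measurable \<pi>"
proof -
  have "continuous_on UNIV (\<lambda>x. outcome (z, fst x) (snd x))"
    unfolding outcome_def case_prod_unfold
    by (intro continuous_intros continuous_on_compose2[OF cont_g[unfolded case_prod_unfold], of _ "\<lambda>x. ((z, fst x), fst (snd (snd x)))", simplified])
  from borel_measurable_continuous_Pair[OF type_measurable assms this] show ?thesis .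
qed

lemma feasible_proj_measurable:
  assumes [measurable]: "s \<in> borel_measurable \<pi>"
  shows "(\<lambda>\<theta>. feasible_proj (z, \<tau> \<theta>) (s \<theta>)) \<in> borel_measurable \<pi>"
proof -
  have [measurable]: "(\<lambda>\<theta>. fst (s \<theta>)) \<in> borel_measurable \<pi>"
    "(\<lambda>\<theta>. fst (snd (s \<theta>))) \<in> borel_measurable \<pi>" "(\<lambda>\<theta>. snd (snd (s \<theta>))) \<in> borel_measurable \<pi>"
    by (rule measurable_compose[OF assms borel_measurable_continuous_onI], intro continuous_intros)+
  show ?thesis
    unfolding feasible_proj_def ins.proj_def out.proj_def case_prod_unfold
    by (intro borel_measurable_Pair) measurable
qed

text \<open>The constant adds the bounds \<open>1\<close>, \<open>E\<close>, \<open>E\<close> and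
  \<open>B\<close> of the four coordinates in the nesting of the pairs.\<close>

lemma outcome_bound:
  assumes "z \<in> Z" "\<theta> \<in> space \<pi>" "s \<in> feasible (z, \<tau> \<theta>)"
  shows "norm (outcome (z, \<tau> \<theta>) s) \<le> 1 + (E + (E + B))"
proof -
  obtain q e e' where s: "s = (q, e, e')" by (cases s)
  have q: "0 \<le> q" "q \<le> 1" and e: "e \<in> {0..E}" "e' \<in> {0..E}"
    using assms(3) ins.minimizers_bounds out.minimizers_bounds
    by (auto simp: s feasible_def opt_in_def)
  have weight: "norm (c * d) \<le> D" if "0 \<le> c" "c \<le> 1" "\<bar>d\<bar> \<le> D" for c d D :: real
    using mult_mono[OF that(2,3)] that by (simp add: abs_mult)
  have "norm (outcome (z, \<tau> \<theta>) s) \<le>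
      norm q + (norm (q * e) + (norm ((1 - q) * e') + norm (q * g (z, \<tau> \<theta>) e)))"
    unfolding s outcome_def prod.case by (intro order_trans[OF norm_Pair_le] add_mono order_refl)
  also have "\<dots> \<le> 1 + (E + (E + B))"
    using q e g_bound[OF assms(1,2) e(1)] by (intro add_mono weight) auto
  finally show ?thesis .
qed

lemma outcome_integrable:
  assumes "z \<in> Z" "s \<in> selections z"
  shows "integrable \<pi> (\<lambda>\<theta>. outcome (z, \<tau> \<theta>) (s \<theta>))"
proof (rule integrable_const_bound[where B = "1 + (E + (E + B))"])
  show "AE \<theta> in \<pi>. norm (outcome (z, \<tau> \<theta>) (s \<theta>)) \<le> 1 + (E + (E + B))"
    using assms by (intro AE_I2 outcome_bound) (auto simp: selections_def)
qed (use assms in \<open>auto simp: selections_def intro: outcome_measurable\<close>)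

lemma aggregate_norm_le:
  assumes "z \<in> Z" "s \<in> selections z"
  shows "norm (aggregate z s) \<le> 1 + (E + (E + B))"
proof -
  have "norm (aggregate z s) \<le> (LINT \<theta>|\<pi>. norm (outcome (z, \<tau> \<theta>) (s \<theta>)))"
    unfolding aggregate_def by (rule integral_norm_bound)
  also have "\<dots> \<le> (LINT \<theta>|\<pi>. 1 + (E + (E + B)))"
    using assms outcome_integrable[OF assms]
    by (intro integral_mono integrable_norm outcome_bound) (auto simp: selections_def)
  finally show ?thesis by (simp add: prob_space)
qed

lemma selections_nonempty:
  assumes "z \<in> Z" shows "selections z \<noteq> {}"
proof -
  \<comment> \<open>Projecting the zero triple selects the smallest optimal efforts, with
    \<open>q = 0\<close> under indifference.\<close>
  have "(\<lambda>\<theta>. feasible_proj (z, \<tau> \<theta>) 0) \<in> selections z"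
    using assms by (auto simp: selections_def convex_ins convex_out
        intro!: feasible_proj_in feasible_proj_measurable)
  then show ?thesis by blast
qed

text \<open>An outcome determines its triple by division, except for the insured effort when
  \<open>q = 0\<close> and the uninsured effort when \<open>q = 1\<close>. There the effort does not
  influence the outcome, and \<open>lo\<close> is a measurable choice.\<close>

lemma outcome_selection:
  assumes [measurable]: "h \<in> borel_measurable \<pi>"
    and h: "\<And>\<theta>. \<theta> \<in> space \<pi> \<Longrightarrow> h \<theta> \<in> outcome (z, \<tau> \<theta>) ` feasible (z, \<tau> \<theta>)"
  obtains s where "s \<in> selections z" "aggregate z s = (LINT \<theta>|\<pi>. h \<theta>)"
proof -
  define s where "s \<theta> = (fst (h \<theta>),
      if fst (h \<theta>) = 0 then ins.lo (z, \<tau> \<theta>) else fst (snd (h \<theta>)) / fst (h \<theta>),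
      if fst (h \<theta>) = 1 then out.lo (z, \<tau> \<theta>) else fst (snd (snd (h \<theta>))) / (1 - fst (h \<theta>)))" for \<theta>
  have s: "s \<theta> \<in> feasible (z, \<tau> \<theta>) \<and> outcome (z, \<tau> \<theta>) (s \<theta>) = h \<theta>" if "\<theta> \<in> space \<pi>" for \<theta>
  proof -
    obtain q e e' where "h \<theta> = outcome (z, \<tau> \<theta>) (q, e, e')" "(q, e, e') \<in> feasible (z, \<tau> \<theta>)"
      using h[OF \<open>\<theta> \<in> space \<pi>\<close>] by (metis imageE prod_cases3)
    then show ?thesis
      by (auto simp: s_def outcome_def feasible_def ins.lo_in out.lo_in)
  qed
  have [measurable]: "(\<lambda>\<theta>. fst (h \<theta>)) \<in> borel_measurable \<pi>"
    "(\<lambda>\<theta>. fst (snd (h \<theta>))) \<in> borel_measurable \<pi>" "(\<lambda>\<theta>. fst (snd (snd (h \<theta>)))) \<in> borel_measurable \<pi>"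
    by (rule measurable_compose[OF assms(1) borel_measurable_continuous_onI], intro continuous_intros)+
  have "s \<in> borel_measurable \<pi>"
    unfolding s_def by (intro borel_measurable_Pair) measurable
  then have "s \<in> selections z"
    using s by (simp add: selections_def)
  moreover have "aggregate z s = (LINT \<theta>|\<pi>. h \<theta>)"
    unfolding aggregate_def using s by (intro Bochner_Integration.integral_cong) auto
  ultimately show ?thesis using that by blast
qed

lemma convex_outcomes_type:
  assumes "z \<in> Z" "\<theta> \<in> space \<pi>"
  shows "convex (outcome (z, \<tau> \<theta>) ` feasible (z, \<tau> \<theta>))"
  using assms by (intro convex_outcomes convex_ins convex_out g_affine)

text \<open>Two selections are mixed in outcome space, type by type, and the mixture is turned back
  into a selection; this works for any distribution of types.\<close>

lemma convex_aggregates: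
  assumes "z \<in> Z"
  shows "convex (aggregate z ` selections z)"
proof (rule convexI)
  fix y1 y2 and u v :: real
  assume y: "y1 \<in> aggregate z ` selections z" "y2 \<in> aggregate z ` selections z"
    and uv: "0 \<le> u" "0 \<le> v" "u + v = 1"
  then obtain s1 s2 where s: "s1 \<in> selections z" "s2 \<in> selections z"
    and y: "y1 = aggregate z s1" "y2 = aggregate z s2"
    by blast
  define h where "h \<theta> = u *\<^sub>R outcome (z, \<tau> \<theta>) (s1 \<theta>) + v *\<^sub>R outcome (z, \<tau> \<theta>) (s2 \<theta>)" for \<theta>
  have "h \<in> borel_measurable \<pi>"
    using s outcome_measurable unfolding h_def selections_def
    by (intro borel_measurable_add borel_measurable_scaleR borel_measurable_const) auto
  moreover have "h \<theta> \<in> outcome (z, \<tau> \<theta>) ` feasible (z, \<tau> \<theta>)" if "\<theta> \<in> space \<pi>" for \<theta>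
    unfolding h_def using s that
    by (intro convexD[OF convex_outcomes_type[OF assms that]] imageI uv) (auto simp: selections_def)
  ultimately obtain s where "s \<in> selections z" "aggregate z s = (LINT \<theta>|\<pi>. h \<theta>)"
    using outcome_selection by blast
  moreover have "(LINT \<theta>|\<pi>. h \<theta>) = u *\<^sub>R y1 + v *\<^sub>R y2"
    unfolding h_def y aggregate_def using outcome_integrable[OF assms] s by simp
  ultimately show "u *\<^sub>R y1 + v *\<^sub>R y2 \<in> aggregate z ` selections z"
    by (metis imageI)
qed

text \<open>
  Projecting the selections at the parameters \<open>X n\<close> onto the feasible sets at the limit parameter
  changes the integrals by a null sequence; this reduces the claim to a single parameter.
\<close>

lemma aggregates_limit:
  assumes X: "X \<longlonglongrightarrow> z" "\<And>n. X n \<in> Z" and z: "z \<in> Z"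
    and s: "\<And>n. s n \<in> selections (X n)" and y: "(\<lambda>n. aggregate (X n) (s n)) \<longlonglongrightarrow> y"
  shows "y \<in> aggregate z ` selections z"
proof -
  define h where "h n \<theta> = outcome (z, \<tau> \<theta>) (feasible_proj (z, \<tau> \<theta>) (s n \<theta>))" for n \<theta>
  have proj_sel: "(\<lambda>\<theta>. feasible_proj (z, \<tau> \<theta>) (s n \<theta>)) \<in> selections z" for n
  proof -
    have "0 \<le> fst (s n \<theta>) \<and> fst (s n \<theta>) \<le> 1" if "\<theta> \<in> space \<pi>" for \<theta>
      using s[of n] that by (auto simp: selections_def feasible_def opt_in_def mem_Times_iff)
    then show ?thesis
      using s[of n] z by (auto simp: selections_def convex_ins convex_out
          intro!: feasible_proj_in feasible_proj_measurable)
  qed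
  have [measurable]: "h n \<in> borel_measurable \<pi>"
    "(\<lambda>\<theta>. outcome (X n, \<tau> \<theta>) (s n \<theta>)) \<in> borel_measurable \<pi>" for n
    using s[of n] proj_sel[of n] unfolding h_def selections_def
    by (auto intro!: outcome_measurable)
  have h_in: "h n \<theta> \<in> outcome (z, \<tau> \<theta>) ` feasible (z, \<tau> \<theta>)" if "\<theta> \<in> space \<pi>" for n \<theta>
    using proj_sel[of n] that by (auto simp: h_def selections_def)
  have h_bound: "norm y \<le> 1 + (E + (E + B))"
    if "\<theta> \<in> space \<pi>" "y \<in> outcome (z, \<tau> \<theta>) ` feasible (z, \<tau> \<theta>)" for y \<theta>
    using that outcome_bound[OF z] by auto
  have "(\<lambda>n. LINT \<theta>|\<pi>. outcome (X n, \<tau> \<theta>) (s n \<theta>) - h n \<theta>) \<longlonglongrightarrow> (LINT \<theta>|\<pi>. 0)"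
  proof (rule integral_dominated_convergence[where w = "\<lambda>_. (1 + (E + (E + B))) + (1 + (E + (E + B)))"])
    show "AE \<theta> in \<pi>. (\<lambda>n. outcome (X n, \<tau> \<theta>) (s n \<theta>) - h n \<theta>) \<longlonglongrightarrow> 0"
    proof (rule AE_I2)
      fix \<theta> assume "\<theta> \<in> space \<pi>"
      then show "(\<lambda>n. outcome (X n, \<tau> \<theta>) (s n \<theta>) - h n \<theta>) \<longlonglongrightarrow> 0"
        unfolding h_def using s
        by (intro outcome_proj_tendsto tendsto_intros X) (auto simp: selections_def)
    qed
    show "AE \<theta> in \<pi>. norm (outcome (X n, \<tau> \<theta>) (s n \<theta>) - h n \<theta>) \<le> (1 + (E + (E + B))) + (1 + (E + (E + B)))" for n
    proof (rule AE_I2)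
      fix \<theta> assume \<theta>: "\<theta> \<in> space \<pi>"
      have "norm (outcome (X n, \<tau> \<theta>) (s n \<theta>)) \<le> 1 + (E + (E + B))"
        using s[of n] \<theta> by (intro outcome_bound X) (auto simp: selections_def)
      then show "norm (outcome (X n, \<tau> \<theta>) (s n \<theta>) - h n \<theta>) \<le> (1 + (E + (E + B))) + (1 + (E + (E + B)))"
        using h_bound[OF \<theta> h_in[OF \<theta>, of n]]
        by (intro norm_triangle_le_diff add_mono)
    qed
  qed auto
  moreover have "(LINT \<theta>|\<pi>. outcome (X n, \<tau> \<theta>) (s n \<theta>) - h n \<theta>) =
      aggregate (X n) (s n) - (LINT \<theta>|\<pi>. h n \<theta>)" for n
    unfolding aggregate_def h_def
    by (intro Bochner_Integration.integral_diff outcome_integrable X s z proj_sel)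
  ultimately have "(\<lambda>n. aggregate (X n) (s n) - (LINT \<theta>|\<pi>. h n \<theta>)) \<longlonglongrightarrow> 0"
    by simp
  from tendsto_diff[OF y this] have "(\<lambda>n. LINT \<theta>|\<pi>. h n \<theta>) \<longlonglongrightarrow> y"
    by simp
  then have "\<exists>f\<in>borel_measurable \<pi>.
      (\<forall>\<theta>\<in>space \<pi>. f \<theta> \<in> outcome (z, \<tau> \<theta>) ` feasible (z, \<tau> \<theta>)) \<and> (LINT \<theta>|\<pi>. f \<theta>) = y"
    by (intro convex_selection_integral_limit[where h = h and B = "1 + (E + (E + B))"]
        convex_outcomes_type z compact_imp_closed compact_outcomes h_bound h_in) auto
  then obtain f where f: "f \<in> borel_measurable \<pi>"
    "\<And>\<theta>. \<theta> \<in> space \<pi> \<Longrightarrow> f \<theta> \<in> outcome (z, \<tau> \<theta>) ` feasible (z, \<tau> \<theta>)" "(LINT \<theta>|\<pi>. f \<theta>) = y"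
    by blast
  obtain s' where "s' \<in> selections z" "aggregate z s' = (LINT \<theta>|\<pi>. f \<theta>)"
    using outcome_selection[OF f(1,2)] by blast
  then show ?thesis
    using f(3) by (metis imageI)
qed

lemma compact_aggregate_graph: "compact {(z, y). z \<in> Z \<and> y \<in> aggregate z ` selections z}"
  (is "compact ?\<Gamma>")
proof -
  have "closed ?\<Gamma>"
    unfolding closed_sequential_limits
  proof (intro allI impI, elim conjE)
    fix P and p :: "'z \<times> real \<times> real \<times> real \<times> real"
    assume P: "\<forall>n. P n \<in> ?\<Gamma>" "P \<longlonglongrightarrow> p"
    have lim: "(\<lambda>n. fst (P n)) \<longlonglongrightarrow> fst p" "(\<lambda>n. snd (P n)) \<longlonglongrightarrow> snd p"
      by (intro tendsto_intros P)+
    have PZ: "fst (P n) \<in> Z" and "snd (P n) \<in> aggregate (fst (P n)) ` selections (fst (P n))" for n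
      using P(1)[rule_format, of n] by auto
    then have "\<exists>s. s \<in> selections (fst (P n)) \<and> snd (P n) = aggregate (fst (P n)) s" for n
      by blast
    then obtain s where s: "\<And>n. s n \<in> selections (fst (P n))"
      "\<And>n. snd (P n) = aggregate (fst (P n)) (s n)"
      by metis
    have z: "fst p \<in> Z"
      using closed_sequentially[OF compact_imp_closed[OF compact_Z] PZ lim(1)] .
    have "snd p \<in> aggregate (fst p) ` selections (fst p)"
      by (rule aggregates_limit[OF lim(1) PZ z s(1)]) (use lim(2) s(2) in simp)
    with z show "p \<in> ?\<Gamma>"
      by (simp add: case_prod_unfold)
  qed
  then have "compact (Z \<times> cball 0 (1 + (E + (E + B))) \<inter> ?\<Gamma>)"
    by (intro compact_Int_closed compact_Times compact_Z compact_cball)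
  moreover have "Z \<times> cball 0 (1 + (E + (E + B))) \<inter> ?\<Gamma> = ?\<Gamma>"
    by (rule Int_absorb1) (use aggregate_norm_le in auto)
  ultimately show ?thesis by simp
qed

end

section \<open>Fixed points and extremal values of correspondences\<close>

text \<open>\<open>U\<close> collects the points \<open>m\<close> at which some value of
  \<open>l\<close> is at least \<open>m\<close>, \<open>D\<close> those at which some value is at
  most \<open>m\<close>. Both are compact as projections, they cover the interval, \<open>0\<close>
  lies in \<open>U\<close> and \<open>E\<close> in \<open>D\<close>. Connectedness gives a common
  point, where the convex set of values of \<open>l\<close> contains \<open>m\<close>
  itself.\<close>

lemma interval_correspondence_fixed_point:
  fixes I :: "real \<Rightarrow> 'b::euclidean_space set" and l :: "'b \<Rightarrow> real"
  assumes "0 \<le> E" and compact: "compact {(m, y). m \<in> {0..E} \<and> y \<in> I m}"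
    and convex: "\<And>m. m \<in> {0..E} \<Longrightarrow> convex (I m)" and nonempty: "\<And>m. m \<in> {0..E} \<Longrightarrow> I m \<noteq> {}"
    and l: "linear l" and range: "\<And>m y. m \<in> {0..E} \<Longrightarrow> y \<in> I m \<Longrightarrow> l y \<in> {0..E}"
  obtains m y where "m \<in> {0..E}" "y \<in> I m" "l y = m"
proof -
  define \<Gamma> where "\<Gamma> = {(m, y). m \<in> {0..E} \<and> y \<in> I m}"
  have cont: "continuous_on UNIV (\<lambda>p. l (snd p))"
    by (intro continuous_on_compose2[OF linear_continuous_on[of l UNIV]] continuous_intros)
      (use l in \<open>auto simp: linear_conv_bounded_linear\<close>)
  define U where "U = fst ` (\<Gamma> \<inter> {p. fst p \<le> l (snd p)})"
  define D where "D = fst ` (\<Gamma> \<inter> {p. l (snd p) \<le> fst p})"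
  have "closed {p. fst p \<le> l (snd p)}" "closed {p. l (snd p) \<le> fst p}"
    by (intro closed_Collect_le cont continuous_intros)+
  then have "compact U" "compact D"
    unfolding U_def D_def using compact
    by (auto simp: \<Gamma>_def intro!: compact_continuous_image compact_Int_closed continuous_intros)
  moreover have "{0..E} \<subseteq> U \<union> D"
  proof
    fix m assume m: "m \<in> {0..E}"
    then obtain y where "y \<in> I m" using nonempty by blast
    then have "(m, y) \<in> \<Gamma>" using m by (simp add: \<Gamma>_def)
    then show "m \<in> U \<union> D"
      unfolding U_def D_def by (cases "m \<le> l y") force+
  qed
  moreover have "0 \<in> U"
  proof -
    obtain y where "y \<in> I 0" using nonempty[of 0] \<open>0 \<le> E\<close> by auto
    then have "(0, y) \<in> \<Gamma> \<inter> {p. fst p \<le> l (snd p)}"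
      using range[of 0 y] \<open>0 \<le> E\<close> by (simp add: \<Gamma>_def)
    then show ?thesis unfolding U_def by force
  qed
  moreover have "E \<in> D"
  proof -
    obtain y where "y \<in> I E" using nonempty[of E] \<open>0 \<le> E\<close> by auto
    then have "(E, y) \<in> \<Gamma> \<inter> {p. l (snd p) \<le> fst p}"
      using range[of E y] \<open>0 \<le> E\<close> by (simp add: \<Gamma>_def)
    then show ?thesis unfolding D_def by force
  qed
  ultimately have "U \<inter> D \<inter> {0..E} \<noteq> {}"
    using connected_closedD[OF connected_Icc, of U D 0 E] compact_imp_closed \<open>0 \<le> E\<close> by fastforce
  then obtain m y1 y2 where m: "m \<in> {0..E}" and y: "y1 \<in> I m" "m \<le> l y1" "y2 \<in> I m" "l y2 \<le> m"
    unfolding U_def D_def \<Gamma>_def by fastforce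
  have "convex (l ` I m)"
    by (rule convex_linear_image[OF l convex[OF m]])
  then have "is_interval (l ` I m)"
    by (simp add: is_interval_convex_1)
  from mem_is_interval_1_I[OF this imageI[OF y(3)] imageI[OF y(1)] y(4,2)]
  show ?thesis using that m by blast
qed

text \<open>An open set of reals is a countable union of compact sets, and the projection of a
  compact set is compact, hence Borel.\<close>

lemma compact_projection_open_borel:
  fixes \<Gamma> :: "('a::metric_space \<times> real) set"
  assumes "compact \<Gamma>" "open S"
  shows "{k. \<exists>j. (k, j) \<in> \<Gamma> \<and> j \<in> S} \<in> sets borel"
proof -
  obtain C :: "nat \<Rightarrow> real set" where C: "\<And>n. compact (C n)" "(\<Union>n. C n) = S"
    by (rule open_Union_compact_subsets[OF \<open>open S\<close>], rule that) assumption+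
  have "{k. \<exists>j. (k, j) \<in> \<Gamma> \<and> j \<in> S} = (\<Union>n. fst ` (\<Gamma> \<inter> UNIV \<times> C n))"
    unfolding C(2)[symmetric] by force
  moreover have "fst ` (\<Gamma> \<inter> UNIV \<times> C n) \<in> sets borel" for n
    by (intro borel_closed compact_imp_closed compact_continuous_image compact_Int_closed
        closed_Times closed_UNIV C assms continuous_intros)
  ultimately show ?thesis by auto
qed

text \<open>The supremum of a fibre exceeds \<open>y\<close> exactly if some point of the fibre
  does, so the level sets are projections over open rays; the infimum is symmetric. Empty fibres fit
  in, with values minus infinity and infinity.\<close>

lemma compact_graph_SUP_INF_measurable:
  fixes \<Gamma> :: "('a::metric_space \<times> real) set"
  assumes "compact \<Gamma>"
  shows "(\<lambda>k. SUP j\<in>{j. (k, j) \<in> \<Gamma>}. ereal j) \<in> borel_measurable borel"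
    and "(\<lambda>k. INF j\<in>{j. (k, j) \<in> \<Gamma>}. ereal j) \<in> borel_measurable borel"
proof -
  have "open {j. y < ereal j}" "open {j. ereal j < y}" for y
    by (intro open_Collect_less continuous_intros)+
  note * = this[THEN compact_projection_open_borel[OF assms]]
  show "(\<lambda>k. SUP j\<in>{j. (k, j) \<in> \<Gamma>}. ereal j) \<in> borel_measurable borel"
    by (rule borel_measurableI_greater) (use *(1) in \<open>simp add: less_SUP_iff\<close>)
  show "(\<lambda>k. INF j\<in>{j. (k, j) \<in> \<Gamma>}. ereal j) \<in> borel_measurable borel"
    by (rule borel_measurableI_less) (use *(2) in \<open>simp add: INF_less_iff\<close>)
qed

lemma ereal_SUP_approx:
  fixes f :: "'a \<Rightarrow> ereal"
  assumes "K \<noteq> {}" "\<And>k. k \<in> K \<Longrightarrow> \<bar>f k\<bar> \<noteq> \<infinity>" "\<And>k. k \<in> K \<Longrightarrow> f k \<le> ereal B" "0 < \<epsilon>"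
  shows "\<exists>k\<in>K. (SUP k\<in>K. f k) - ereal \<epsilon> \<le> f k"
proof -
  obtain k where "k \<in> K" using assms(1) by blast
  then have "- \<infinity> < f k" "f k \<le> (SUP k\<in>K. f k)"
    using assms(2)[of k] by (auto intro: SUP_upper simp: ereal_infinity_cases)
  moreover have "(SUP k\<in>K. f k) \<le> ereal B"
    by (rule SUP_least) (rule assms(3))
  ultimately have "\<bar>SUP k\<in>K. f k\<bar> \<noteq> \<infinity>"
    by auto
  \<comment> \<open>Finiteness matters here: subtracting \<open>\<epsilon>\<close> from an infinite
    supremum would not change it.\<close>
  then have "(SUP k\<in>K. f k) - ereal \<epsilon> < (SUP k\<in>K. f k)"
    using \<open>0 < \<epsilon>\<close> by (cases "SUP k\<in>K. f k") auto
  then show ?thesis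
    by (auto simp: less_SUP_iff intro: less_imp_le)
qed

lemma convex_on_shift:
  fixes f :: "real \<Rightarrow> real"
  assumes "convex_on {0..E + D} f" "0 \<le> d" "d \<le> D"
  shows "convex_on {0..E} (\<lambda>e. f (e + d))"
proof (rule convex_onI)
  fix t a b :: real
  assume t: "0 < t" "t < 1" and ab: "a \<in> {0..E}" "b \<in> {0..E}"
  have "f ((1 - t) *\<^sub>R (a + d) + t *\<^sub>R (b + d)) \<le> (1 - t) * f (a + d) + t * f (b + d)"
    using assms t ab by (intro convex_onD) auto
  also have "(1 - t) *\<^sub>R (a + d) + t *\<^sub>R (b + d) = (1 - t) *\<^sub>R a + t *\<^sub>R b + d"
    by (simp add: algebra_simps)
  finally show "f ((1 - t) *\<^sub>R a + t *\<^sub>R b + d) \<le> (1 - t) * f (a + d) + t * f (b + d)" .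
qed simp

lemma convex_on_affine_real:
  fixes S :: "real set"
  assumes "convex S"
  shows "convex_on S (\<lambda>e. u + v * e + w)"
  by (rule convex_onI) (auto simp: algebra_simps assms)

lemma convex_on_eqI:
  assumes "convex_on S f" "\<And>s. s \<in> S \<Longrightarrow> g s = f s"
  shows "convex_on S g"
proof (rule convex_onI)
  show "convex S"
    using assms(1) by (rule convex_on_imp_convex)
  fix t a b
  assume *: "0 < (t::real)" "t < 1" "a \<in> S" "b \<in> S"
  then have "(1 - t) *\<^sub>R a + t *\<^sub>R b \<in> S"
    using convexD[OF \<open>convex S\<close>, of a b "1 - t" t] by simp
  with * show "g ((1 - t) *\<^sub>R a + t *\<^sub>R b) \<le> (1 - t) * g a + t * g b"
    using convex_onD[OF assms(1), of t a b] by (simp add: assms(2))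
qed

section \<open>The insurance market\<close>

locale insurance_market = prob_space \<pi>
  for \<pi> :: "'t measure" +
  fixes x E_max p_max \<alpha>_max \<beta>_max :: real and mu lam :: "real \<Rightarrow> real" and \<gamma> c \<sigma> :: "'t \<Rightarrow> real"
  assumes x_nonneg: "0 \<le> x"
    and max_nonneg: "0 \<le> p_max" "0 \<le> \<alpha>_max" "0 \<le> \<beta>_max" "0 \<le> E_max"
    and \<beta>_max_less: "\<beta>_max < 1"
    and mu: "continuous_on {0..(1 + x) * E_max} mu" "convex_on {0..(1 + x) * E_max} mu"
    and lam: "continuous_on {0..(1 + x) * E_max} lam" "convex_on {0..(1 + x) * E_max} lam"
    and types: "\<gamma> \<in> borel_measurable \<pi>" "c \<in> borel_measurable \<pi>" "\<sigma> \<in> borel_measurable \<pi>"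
    and \<gamma>_pos: "\<And>\<theta>. \<theta> \<in> space \<pi> \<Longrightarrow> 0 < \<gamma> \<theta>"
begin

abbreviation "K \<equiv> contract_set p_max \<alpha>_max \<beta>_max"
abbreviation "Eq \<equiv> equilibria \<pi> x E_max mu lam \<gamma> c \<sigma>"

text \<open>
  Outside \<open>{0..(1 + x) * E_max}\<close> nothing is known about \<open>mu\<close> and \<open>lam\<close>; precomposing with
  the retraction onto this interval makes all objectives continuous everywhere.
\<close>

definition retract :: "real \<Rightarrow> real" where
  "retract z = max 0 (min ((1 + x) * E_max) z)"

text \<open>The certainty equivalents are reused with the coordinate projections in the roles of
  \<open>\<gamma>\<close>, \<open>c\<close> and \<open>\<sigma>\<close>. A type thus becomes a point
  of Euclidean space, and the objective is jointly continuous in everything.\<close>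

definition obj_in :: "(contract \<times> real) \<times> (real \<times> real \<times> real) \<Rightarrow> real \<Rightarrow> real" where
  "obj_in \<xi> e = CE_in x (mu \<circ> retract) (lam \<circ> retract) fst (fst \<circ> snd) (snd \<circ> snd)
     (fst (fst \<xi>)) e (snd \<xi>) (snd (fst \<xi>))"

definition obj_out :: "(contract \<times> real) \<times> (real \<times> real \<times> real) \<Rightarrow> real \<Rightarrow> real" where
  "obj_out \<xi> e = CE_out x (mu \<circ> retract) (lam \<circ> retract) fst (fst \<circ> snd) e (snd \<xi>) (snd (fst \<xi>))"

text \<open>The insurer's profit from one insured agent. It is the same for all types; the full
  parameter \<open>\<xi>\<close> appears so that it can instantiate \<open>g\<close>.\<close>

definition margin :: "(contract \<times> real) \<times> (real \<times> real \<times> real) \<Rightarrow> real \<Rightarrow> real" where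
  "margin \<xi> e = (case fst \<xi> of ((p, \<alpha>, \<beta>), m) \<Rightarrow> p - \<alpha> * e - \<beta> * (mu \<circ> retract) (e + x * m))"

definition type_of :: "'t \<Rightarrow> real \<times> real \<times> real" where
  "type_of \<theta> = (\<gamma> \<theta>, c \<theta>, \<sigma> \<theta>)"

lemma continuous_retract:
  assumes "continuous_on {0..(1 + x) * E_max} f"
  shows "continuous_on UNIV (f \<circ> retract)"
proof -
  have "0 \<le> (1 + x) * E_max"
    using x_nonneg max_nonneg by simp
  then show ?thesis
    unfolding o_def retract_def
    by (intro continuous_on_compose2[OF assms] continuous_intros) auto
qed

lemma continuous_obj:
  "continuous_on UNIV (\<lambda>(\<xi>, e). obj_in \<xi> e)" "continuous_on UNIV (\<lambda>(\<xi>, e). obj_out \<xi> e)"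
  "continuous_on UNIV (\<lambda>(\<xi>, e). margin \<xi> e)"
  unfolding obj_in_def obj_out_def margin_def CE_in_def CE_out_def case_prod_unfold o_apply[of fst] o_apply[of snd]
  by (intro continuous_intros continuous_on_compose2[OF continuous_retract[OF mu(1)]]
      continuous_on_compose2[OF continuous_retract[OF lam(1)]]; simp)+

lemma retract_eq:
  assumes "e \<in> {0..E_max}" "m \<in> {0..E_max}"
  shows "retract (e + x * m) = e + x * m"
proof -
  have "0 \<le> x * m" "x * m \<le> x * E_max"
    using assms x_nonneg by (auto intro: mult_left_mono)
  then show ?thesis
    using assms by (simp add: retract_def distrib_right)
qed

lemma obj_eq:
  assumes "e \<in> {0..E_max}" "m \<in> {0..E_max}"
  shows "obj_in ((k, m), type_of \<theta>) e = CE_in x mu lam \<gamma> c \<sigma> k e \<theta> m"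
    and "obj_out ((k, m), type_of \<theta>) e = CE_out x mu lam \<gamma> c e \<theta> m"
  using retract_eq[OF assms]
  by (simp_all add: obj_in_def obj_out_def CE_in_def CE_out_def type_of_def split: prod.split)

lemma convex_effort:
  assumes "convex_on {0..(1 + x) * E_max} f" "m \<in> {0..E_max}"
  shows "convex_on {0..E_max} (\<lambda>e. (f \<circ> retract) (e + x * m))"
proof -
  have "convex_on {0..E_max} (\<lambda>e. f (e + x * m))"
    using assms x_nonneg by (intro convex_on_shift[where D = "x * E_max"])
      (auto simp: distrib_right intro: mult_left_mono)
  then show ?thesis
    by (rule convex_on_eqI) (simp add: retract_eq[OF _ assms(2)])
qed

sublocale opt_in_choice obj_in obj_out E_max margin
  by unfold_locales (use continuous_obj max_nonneg in auto)

section \<open>Convexity of the optimal efforts and the insurer's margin\<close>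

lemma K_bounds:
  assumes "(p, \<alpha>, \<beta>) \<in> K"
  shows "0 \<le> \<beta>" "\<beta> < 1"
  using assms \<beta>_max_less by (auto simp: contract_set_def)

lemma compact_K: "compact K"
  unfolding contract_set_def by (intro compact_Times compact_Icc)

text \<open>All of the insured objective except its \<open>mu\<close> term: the summand
  \<open>\<rho>\<close> when affinity of \<open>mu\<close> on the optimal efforts is
  derived.\<close>

lemma convex_obj_in_remainder:
  assumes "m \<in> {0..E_max}" "\<theta> \<in> space \<pi>"
  shows "convex_on {0..E_max} (\<lambda>e. p + (c \<theta> - \<alpha>) * e + 1 / 2 * \<gamma> \<theta> * \<alpha>\<^sup>2 * (\<sigma> \<theta>)\<^sup>2 +
    1 / 2 * \<gamma> \<theta> * (1 - \<beta>)\<^sup>2 * (lam \<circ> retract) (e + x * m))"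
proof -
  have affine: "convex_on {0..E_max} (\<lambda>e. p + (c \<theta> - \<alpha>) * e + 1 / 2 * \<gamma> \<theta> * \<alpha>\<^sup>2 * (\<sigma> \<theta>)\<^sup>2)"
    by (rule convex_on_affine_real) simp
  show ?thesis
    using \<gamma>_pos[OF assms(2)]
    by (intro convex_on_add affine convex_on_cmul convex_effort lam assms(1)) auto
qed

lemma obj_in_split:
  "obj_in (((p, \<alpha>, \<beta>), m), type_of \<theta>) e = (1 - \<beta>) * (mu \<circ> retract) (e + x * m) +
    (p + (c \<theta> - \<alpha>) * e + 1 / 2 * \<gamma> \<theta> * \<alpha>\<^sup>2 * (\<sigma> \<theta>)\<^sup>2 +
      1 / 2 * \<gamma> \<theta> * (1 - \<beta>)\<^sup>2 * (lam \<circ> retract) (e + x * m))"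
  by (simp add: obj_in_def CE_in_def type_of_def)

lemma convex_ins_minimizers:
  assumes "z \<in> K \<times> {0..E_max}" "\<theta> \<in> space \<pi>"
  shows "convex (ins.minimizers (z, type_of \<theta>))"
proof -
  obtain p \<alpha> \<beta> m where z: "z = ((p, \<alpha>, \<beta>), m)" by (metis prod.exhaust)
  have *: "(p, \<alpha>, \<beta>) \<in> K" "m \<in> {0..E_max}" using assms(1) by (auto simp: z)
  show ?thesis
    unfolding z using K_bounds[OF *(1)]
    by (intro ins.convex_minimizers)
      (unfold obj_in_split, intro convex_on_add convex_obj_in_remainder convex_on_cmul convex_effort mu * assms(2), simp)
qed

lemma convex_out_minimizers:
  assumes "z \<in> K \<times> {0..E_max}" "\<theta> \<in> space \<pi>"
  shows "convex (out.minimizers (z, type_of \<theta>))"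
proof -
  obtain k m where z: "z = (k, m)" and m: "m \<in> {0..E_max}"
    using assms(1) by auto
  have split: "obj_out ((k, m), type_of \<theta>) = (\<lambda>e. (mu \<circ> retract) (e + x * m) + c \<theta> * e +
      (1 / 2 * \<gamma> \<theta>) * (lam \<circ> retract) (e + x * m))"
    by (simp add: obj_out_def CE_out_def type_of_def fun_eq_iff)
  have affine: "convex_on {0..E_max} (\<lambda>e. c \<theta> * e)"
    using convex_on_affine_real[of "{0..E_max}" 0 "c \<theta>" 0] by simp
  show ?thesis
    unfolding z using \<gamma>_pos[OF assms(2)]
    by (intro out.convex_minimizers) (unfold split, intro convex_on_add[OF convex_on_add]
        affine convex_on_cmul[of "1 / 2 * \<gamma> \<theta>"] convex_effort mu lam m, simp)
qed

lemma margin_affine: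
  assumes "z \<in> K \<times> {0..E_max}" "\<theta> \<in> space \<pi>"
    and ab: "a \<in> ins.minimizers (z, type_of \<theta>)" "b \<in> ins.minimizers (z, type_of \<theta>)"
    and t: "0 \<le> t" "t \<le> 1"
  shows "margin (z, type_of \<theta>) ((1 - t) * a + t * b) =
    (1 - t) * margin (z, type_of \<theta>) a + t * margin (z, type_of \<theta>) b"
proof -
  obtain p \<alpha> \<beta> m where z: "z = ((p, \<alpha>, \<beta>), m)" by (metis prod.exhaust)
  have *: "(p, \<alpha>, \<beta>) \<in> K" "m \<in> {0..E_max}" using assms(1) by (auto simp: z)
  \<comment> \<open>The positive weight \<open>w\<close> is \<open>1 - \<beta>\<close>.\<close>
  have mu_eq: "(mu \<circ> retract) ((1 - t) * a + t * b + x * m) =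
      (1 - t) * (mu \<circ> retract) (a + x * m) + t * (mu \<circ> retract) (b + x * m)"
    by (rule ins.minimizers_affine_summand[where \<phi> = "\<lambda>e. (mu \<circ> retract) (e + x * m)",
          OF convex_effort[OF mu(2) *(2)] convex_obj_in_remainder[OF *(2) assms(2)] _ obj_in_split
            ab[unfolded z] t])
      (use K_bounds[OF *(1)] in simp)
  show ?thesis
    unfolding margin_def z fst_conv prod.case mu_eq by (simp add: algebra_simps)
qed

lemma margin_bounded:
  obtains B where "\<And>z \<theta> e. z \<in> K \<times> {0..E_max} \<Longrightarrow> e \<in> {0..E_max} \<Longrightarrow> \<bar>margin (z, type_of \<theta>) e\<bar> \<le> B"
proof -
  \<comment> \<open>Fixing the type at \<open>0\<close> leaves a continuous function on a compact
    set of contracts, mean efforts and efforts.\<close>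
  have "continuous_on ((K \<times> {0..E_max}) \<times> {0..E_max}) (\<lambda>y. margin (fst y, 0) (snd y))"
    by (rule continuous_on_compose2[OF continuous_obj(3), of _ "\<lambda>y. ((fst y, 0), snd y)", simplified])
      (intro continuous_intros)
  then have "bounded ((\<lambda>y. margin (fst y, 0) (snd y)) ` ((K \<times> {0..E_max}) \<times> {0..E_max}))"
    by (intro compact_imp_bounded compact_continuous_image compact_Times compact_K compact_Icc)
  then obtain B where B: "\<And>z e. z \<in> K \<times> {0..E_max} \<Longrightarrow> e \<in> {0..E_max} \<Longrightarrow> \<bar>margin (z, 0) e\<bar> \<le> B"
    unfolding bounded_iff by fastforce
  have "margin (z, type_of \<theta>) e = margin (z, 0) e" for z \<theta> e
    by (simp add: margin_def)
  with B show ?thesis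
    using that by metis
qed

text \<open>The interpretation of \<open>population\<close> takes the bound as a term, so one is
  fixed by choice.\<close>

definition margin_bound :: real where
  "margin_bound = (SOME B. \<forall>z \<theta> e. z \<in> K \<times> {0..E_max} \<longrightarrow> e \<in> {0..E_max} \<longrightarrow>
     \<bar>margin (z, type_of \<theta>) e\<bar> \<le> B)"

lemma margin_le_bound:
  assumes "z \<in> K \<times> {0..E_max}" "e \<in> {0..E_max}"
  shows "\<bar>margin (z, type_of \<theta>) e\<bar> \<le> margin_bound"
proof -
  have "\<exists>B. \<forall>z \<theta> e. z \<in> K \<times> {0..E_max} \<longrightarrow> e \<in> {0..E_max} \<longrightarrow> \<bar>margin (z, type_of \<theta>) e\<bar> \<le> B"
    by (rule margin_bounded) blast
  from someI_ex[OF this] show ?thesis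
    using assms unfolding margin_bound_def by blast
qed

sublocale population \<pi> obj_in obj_out E_max margin type_of "K \<times> {0..E_max}" margin_bound
proof unfold_locales
  show "type_of \<in> borel_measurable \<pi>"
    unfolding type_of_def by (intro borel_measurable_Pair types)
qed (auto intro: compact_Times compact_K convex_ins_minimizers convex_out_minimizers margin_affine
    margin_le_bound)

section \<open>Equilibria as fixed points of the aggregate effort\<close>

lemma aggregate_components:
  assumes "(k, m) \<in> K \<times> {0..E_max}" "s \<in> selections (k, m)"
  shows "fst (snd (aggregate (k, m) s)) + fst (snd (snd (aggregate (k, m) s))) =
      (LINT \<theta>|\<pi>. fst (s \<theta>) * fst (snd (s \<theta>)) + (1 - fst (s \<theta>)) * snd (snd (s \<theta>)))"
    and "snd (snd (snd (aggregate (k, m) s))) = (LINT \<theta>|\<pi>. fst (s \<theta>) * margin ((k, m), type_of \<theta>) (fst (snd (s \<theta>))))"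
proof -
  note int = outcome_integrable[OF assms]
  have "bounded_linear (\<lambda>y :: real \<times> real \<times> real \<times> real. fst (snd y) + fst (snd (snd y)))"
    by (intro bounded_linear_add bounded_linear_fst_comp bounded_linear_snd_comp bounded_linear_ident)
  from integral_bounded_linear[OF this int]
  show "fst (snd (aggregate (k, m) s)) + fst (snd (snd (aggregate (k, m) s))) =
      (LINT \<theta>|\<pi>. fst (s \<theta>) * fst (snd (s \<theta>)) + (1 - fst (s \<theta>)) * snd (snd (s \<theta>)))"
    by (simp add: aggregate_def outcome_def case_prod_unfold)
  have "bounded_linear (\<lambda>y :: real \<times> real \<times> real \<times> real. snd (snd (snd y)))"
    by (intro bounded_linear_snd_comp bounded_linear_ident)
  from integral_bounded_linear[OF this int]
  show "snd (snd (snd (aggregate (k, m) s))) = (LINT \<theta>|\<pi>. fst (s \<theta>) * margin ((k, m), type_of \<theta>) (fst (snd (s \<theta>))))"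
    by (simp add: aggregate_def outcome_def case_prod_unfold)
qed

lemma minimizers_E:
  assumes "m \<in> {0..E_max}"
  shows "ins.minimizers ((k, m), type_of \<theta>) = E_in x E_max mu lam \<gamma> c \<sigma> k \<theta> m"
    and "out.minimizers ((k, m), type_of \<theta>) = E_out x E_max mu lam \<gamma> c \<theta> m"
  unfolding ins.minimizers_def out.minimizers_def E_in_def E_out_def is_arg_min_def
  by (auto simp: obj_eq[OF _ assms] not_less)

text \<open>As \<open>\<gamma> \<theta> > 0\<close>, the utility is strictly decreasing in the
  certainty equivalent, so a larger utility means a smaller certainty equivalent.\<close>

lemma feasible_iff_best_response:
  assumes m: "m \<in> {0..E_max}" and \<theta>: "\<theta> \<in> space \<pi>"
  shows "(q, e, e') \<in> feasible ((k, m), type_of \<theta>) \<longleftrightarrow>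
    (e' \<in> E_out x E_max mu lam \<gamma> c \<theta> m \<and> e \<in> E_in x E_max mu lam \<gamma> c \<sigma> k \<theta> m) \<and>
    q \<in> {0..1} \<and>
    (U_in x mu lam \<gamma> c \<sigma> k e \<theta> m > U_out x mu lam \<gamma> c e' \<theta> m \<longrightarrow> q = 1) \<and>
    (U_in x mu lam \<gamma> c \<sigma> k e \<theta> m < U_out x mu lam \<gamma> c e' \<theta> m \<longrightarrow> q = 0)"
proof (cases "e \<in> {0..E_max} \<and> e' \<in> {0..E_max}")
  case True
  then show ?thesis
    unfolding feasible_iff minimizers_E[OF m] U_in_def U_out_def
    using obj_eq[OF _ m] \<gamma>_pos[OF \<theta>] by (auto simp: mult_less_cancel_left_pos)
next
  case False
  then show ?thesis
    unfolding feasible_iff minimizers_E[OF m] by (auto simp: E_in_def E_out_def is_arg_min_def)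
qed

lemma equilibria_iff_selection:
  assumes "k \<in> K"
  shows "(m, e_in, e_out, q) \<in> Eq k \<longleftrightarrow> m \<in> {0..E_max} \<and>
    (\<lambda>\<theta>. (q \<theta>, e_in \<theta>, e_out \<theta>)) \<in> selections (k, m) \<and>
    fst (snd (aggregate (k, m) (\<lambda>\<theta>. (q \<theta>, e_in \<theta>, e_out \<theta>)))) +
      fst (snd (snd (aggregate (k, m) (\<lambda>\<theta>. (q \<theta>, e_in \<theta>, e_out \<theta>))))) = m"
proof (cases "m \<in> {0..E_max}")
  case True
  let ?s = "\<lambda>\<theta>. (q \<theta>, e_in \<theta>, e_out \<theta>)"
  have meas: "?s \<in> borel_measurable \<pi> \<longleftrightarrow>
      e_in \<in> borel_measurable \<pi> \<and> e_out \<in> borel_measurable \<pi> \<and> q \<in> borel_measurable \<pi>"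
  proof
    assume s: "?s \<in> borel_measurable \<pi>"
    have "(\<lambda>\<theta>. fst (?s \<theta>)) \<in> borel_measurable \<pi>" "(\<lambda>\<theta>. fst (snd (?s \<theta>))) \<in> borel_measurable \<pi>"
      "(\<lambda>\<theta>. snd (snd (?s \<theta>))) \<in> borel_measurable \<pi>"
      by (rule measurable_compose[OF s borel_measurable_continuous_onI], intro continuous_intros)+
    then show "e_in \<in> borel_measurable \<pi> \<and> e_out \<in> borel_measurable \<pi> \<and> q \<in> borel_measurable \<pi>"
      by simp
  qed (auto intro!: borel_measurable_Pair)
  have sel: "?s \<in> selections (k, m) \<longleftrightarrow>
      e_in \<in> borel_measurable \<pi> \<and> e_out \<in> borel_measurable \<pi> \<and> q \<in> borel_measurable \<pi> \<and>
      (\<forall>\<theta>\<in>space \<pi>. e_out \<theta> \<in> E_out x E_max mu lam \<gamma> c \<theta> m \<and>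
        e_in \<theta> \<in> E_in x E_max mu lam \<gamma> c \<sigma> k \<theta> m) \<and>
      (\<forall>\<theta>\<in>space \<pi>. q \<theta> \<in> {0..1} \<and>
        (U_in x mu lam \<gamma> c \<sigma> k (e_in \<theta>) \<theta> m > U_out x mu lam \<gamma> c (e_out \<theta>) \<theta> m \<longrightarrow> q \<theta> = 1) \<and>
        (U_in x mu lam \<gamma> c \<sigma> k (e_in \<theta>) \<theta> m < U_out x mu lam \<gamma> c (e_out \<theta>) \<theta> m \<longrightarrow> q \<theta> = 0))"
    unfolding selections_def mem_Collect_eq meas
    using feasible_iff_best_response[OF True] by (simp add: ball_conj_distrib)
  show ?thesis
  proof (cases "?s \<in> selections (k, m)")
    case s: True
    have "fst (snd (aggregate (k, m) ?s)) + fst (snd (snd (aggregate (k, m) ?s))) =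
        (LINT \<theta>|\<pi>. q \<theta> * e_in \<theta> + (1 - q \<theta>) * e_out \<theta>)"
      using aggregate_components(1)[OF _ s] assms True by simp
    then show ?thesis
      using s[unfolded sel] s True unfolding equilibria_def by auto
  next
    case False
    then show ?thesis
      using False[unfolded sel] unfolding equilibria_def by blast
  qed
next
  case False
  then show ?thesis
    unfolding equilibria_def by blast
qed

lemma profit_eq_aggregate:
  assumes "k \<in> K" "m \<in> {0..E_max}" "(\<lambda>\<theta>. (q \<theta>, e_in \<theta>, e_out \<theta>)) \<in> selections (k, m)"
  shows "profit \<pi> x mu k (m, e_in, e_out, q) =
    snd (snd (snd (aggregate (k, m) (\<lambda>\<theta>. (q \<theta>, e_in \<theta>, e_out \<theta>)))))"
proof -
  obtain p \<alpha> \<beta> where k: "k = (p, \<alpha>, \<beta>)" by (metis prod.exhaust)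
  have e: "e_in \<theta> \<in> {0..E_max}" if "\<theta> \<in> space \<pi>" for \<theta>
  proof -
    have "e_in \<theta> \<in> ins.minimizers ((k, m), type_of \<theta>)"
      using assms(3) that by (simp add: selections_def feasible_def)
    from ins.minimizers_bounds[OF this] show ?thesis by simp
  qed
  have "profit \<pi> x mu k (m, e_in, e_out, q) = (LINT \<theta>|\<pi>. q \<theta> * margin ((k, m), type_of \<theta>) (e_in \<theta>))"
    unfolding profit_def k prod.case
    by (intro Bochner_Integration.integral_cong refl)
      (simp add: margin_def retract_eq[OF e assms(2)] mult.commute[of _ "q _"])
  then show ?thesis
    using aggregate_components(2)[OF _ assms(3)] assms(1,2) by simp
qed

definition payoff_graph :: "(contract \<times> real) set" where
  "payoff_graph = {(k, j). k \<in> K \<and> j \<in> profit \<pi> x mu k ` Eq k}"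

text \<open>Exhibits the payoff graph as a continuous image of the compact aggregate graph cut by
  the closed mean-field condition, from which its compactness follows.\<close>

lemma payoff_graph_eq:
  "payoff_graph = (\<lambda>(z, y). (fst z, snd (snd (snd y)))) `
    ({(z, y). z \<in> K \<times> {0..E_max} \<and> y \<in> aggregate z ` selections z} \<inter>
      {(z, y). fst (snd y) + fst (snd (snd y)) = snd z})" (is "_ = ?f ` ?A")
proof (intro equalityI subsetI)
  fix kj assume "kj \<in> payoff_graph"
  then obtain k m e_in e_out q where k: "k \<in> K" and eq: "(m, e_in, e_out, q) \<in> Eq k"
    and kj: "kj = (k, profit \<pi> x mu k (m, e_in, e_out, q))"
    by (auto simp: payoff_graph_def)
  let ?s = "\<lambda>\<theta>. (q \<theta>, e_in \<theta>, e_out \<theta>)"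
  note * = eq[unfolded equilibria_iff_selection[OF k]]
  have "((k, m), aggregate (k, m) ?s) \<in> ?A"
    using * k by auto
  moreover have "kj = ?f ((k, m), aggregate (k, m) ?s)"
    using * profit_eq_aggregate[OF k] kj by simp
  ultimately show "kj \<in> ?f ` ?A" by blast
next
  fix kj assume "kj \<in> ?f ` ?A"
  then obtain k m s where k: "k \<in> K" and m: "m \<in> {0..E_max}" and s: "s \<in> selections (k, m)"
    and fixed: "fst (snd (aggregate (k, m) s)) + fst (snd (snd (aggregate (k, m) s))) = m"
    and kj: "kj = (k, snd (snd (snd (aggregate (k, m) s))))"
    by auto
  define M where "M = (m, (\<lambda>\<theta>. fst (snd (s \<theta>))), (\<lambda>\<theta>. snd (snd (s \<theta>))), (\<lambda>\<theta>. fst (s \<theta>)))"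
  have "M \<in> Eq k"
    unfolding M_def equilibria_iff_selection[OF k] using m s fixed by simp
  moreover have "kj = (k, profit \<pi> x mu k M)"
    unfolding M_def kj using profit_eq_aggregate[OF k m, of "\<lambda>\<theta>. fst (s \<theta>)" "\<lambda>\<theta>. fst (snd (s \<theta>))" "\<lambda>\<theta>. snd (snd (s \<theta>))"] s
    by simp
  ultimately show "kj \<in> payoff_graph"
    using k by (auto simp: payoff_graph_def)
qed

lemma compact_payoff_graph: "compact payoff_graph"
  unfolding payoff_graph_eq case_prod_unfold
  by (intro compact_continuous_image compact_Int_closed
      compact_aggregate_graph[unfolded case_prod_unfold] closed_Collect_eq continuous_intros)

lemma aggregate_effort_range:
  assumes k: "k \<in> K" and m: "m \<in> {0..E_max}" and s: "s \<in> selections (k, m)"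
  shows "fst (snd (aggregate (k, m) s)) + fst (snd (snd (aggregate (k, m) s))) \<in> {0..E_max}"
proof -
  let ?y = "\<lambda>\<theta>. fst (s \<theta>) * fst (snd (s \<theta>)) + (1 - fst (s \<theta>)) * snd (snd (s \<theta>))"
  have y: "0 \<le> ?y \<theta> \<and> ?y \<theta> \<le> E_max" if "\<theta> \<in> space \<pi>" for \<theta>
  proof -
    obtain q e e' where s_eq: "s \<theta> = (q, e, e')" by (metis prod.exhaust)
    have "s \<theta> \<in> feasible ((k, m), type_of \<theta>)"
      using s that by (simp add: selections_def)
    then have "0 \<le> q" "q \<le> 1" and e: "e \<in> ins.minimizers ((k, m), type_of \<theta>)"
      "e' \<in> out.minimizers ((k, m), type_of \<theta>)"
      by (simp_all add: s_eq feasible_def opt_in_def)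
    then show ?thesis
      using ins.minimizers_bounds[OF e(1)] out.minimizers_bounds[OF e(2)]
        convex_bound_le[of e E_max e' q "1 - q"] by (simp add: s_eq)
  qed
  have "0 \<le> (LINT \<theta>|\<pi>. ?y \<theta>)"
    using y by (intro Bochner_Integration.integral_nonneg) simp
  \<comment> \<open>If \<open>?y\<close> is not integrable, its integral is 0 by convention, which
    is still at most \<open>E_max\<close>.\<close>
  moreover have "(LINT \<theta>|\<pi>. ?y \<theta>) \<le> E_max"
  proof (cases "integrable \<pi> ?y")
    case True
    then have "(LINT \<theta>|\<pi>. ?y \<theta>) \<le> (LINT \<theta>|\<pi>. E_max)"
      using y by (intro integral_mono) auto
    then show ?thesis by (simp add: prob_space)
  qed (simp add: not_integrable_integral_eq max_nonneg)
  ultimately show ?thesis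
    using aggregate_components(1)[OF _ s] k m by simp
qed

text \<open>For fixed \<open>k\<close> the correspondence from \<open>m\<close> to the aggregates at
  \<open>(k, m)\<close> has a slice of the joint aggregate graph as its graph, hence a compact one.
  A fixed point of its effort part is an equilibrium mean effort.\<close>

lemma equilibria_nonempty:
  assumes k: "k \<in> K"
  shows "Eq k \<noteq> {}"
proof -
  let ?I = "\<lambda>m. aggregate (k, m) ` selections (k, m)"
  let ?l = "\<lambda>y :: real \<times> real \<times> real \<times> real. fst (snd y) + fst (snd (snd y))"
  have graph: "{(m, y). m \<in> {0..E_max} \<and> y \<in> ?I m} = (\<lambda>w. (snd (fst w), snd w)) `
      ({(z, y). z \<in> K \<times> {0..E_max} \<and> y \<in> aggregate z ` selections z} \<inter> {w. fst (fst w) = k})"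
    (is "?L = ?h ` ?R")
  proof (intro equalityI subsetI)
    fix w assume "w \<in> ?L"
    then have "((k, fst w), snd w) \<in> ?R"
      using k by (simp add: case_prod_unfold)
    then show "w \<in> ?h ` ?R"
      by (rule rev_image_eqI) simp
  next
    fix w assume "w \<in> ?h ` ?R"
    then show "w \<in> ?L"
      by (auto simp: case_prod_unfold)
  qed
  have "compact {(m, y). m \<in> {0..E_max} \<and> y \<in> ?I m}"
    unfolding graph
    by (intro compact_continuous_image compact_Int_closed compact_aggregate_graph closed_Collect_eq
        continuous_intros)
  moreover have "linear ?l"
    by (rule linearI) (auto simp: algebra_simps)
  moreover have "?l y \<in> {0..E_max}" if "m \<in> {0..E_max}" "y \<in> ?I m" for m y
    using that aggregate_effort_range[OF k] by blast
  ultimately obtain m y where m: "m \<in> {0..E_max}" and "y \<in> ?I m" "?l y = m"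
    using interval_correspondence_fixed_point[OF max_nonneg(4), of ?I ?l]
      convex_aggregates selections_nonempty k by (smt (verit, ccfv_threshold) SigmaI image_is_empty)
  then have "((k, m), y) \<in> {(z, y). z \<in> K \<times> {0..E_max} \<and> y \<in> aggregate z ` selections z} \<inter>
      {(z, y). fst (snd y) + fst (snd (snd y)) = snd z}"
    using k by simp
  then have "(k, snd (snd (snd y))) \<in> payoff_graph"
    unfolding payoff_graph_eq by (rule rev_image_eqI) simp
  then show ?thesis
    by (auto simp: payoff_graph_def)
qed

section \<open>Best and worst payoffs as functions of the contract\<close>

lemma J_eq:
  assumes "k \<in> K"
  shows "J_best \<pi> x E_max mu lam \<gamma> c \<sigma> k = (SUP j\<in>{j. (k, j) \<in> payoff_graph}. ereal j)"
    and "J_worst \<pi> x E_max mu lam \<gamma> c \<sigma> k = (INF j\<in>{j. (k, j) \<in> payoff_graph}. ereal j)"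
proof -
  have "{j. (k, j) \<in> payoff_graph} = profit \<pi> x mu k ` Eq k"
    using assms by (auto simp: payoff_graph_def)
  then show "J_best \<pi> x E_max mu lam \<gamma> c \<sigma> k = (SUP j\<in>{j. (k, j) \<in> payoff_graph}. ereal j)"
    "J_worst \<pi> x E_max mu lam \<gamma> c \<sigma> k = (INF j\<in>{j. (k, j) \<in> payoff_graph}. ereal j)"
    by (simp_all add: J_best_def J_worst_def image_image)
qed

text \<open>Compactness of the payoff graph gives one bound for all contracts. The middle inequality
  rests on the existence of an equilibrium, since over an empty set the infimum would be infinity
  and the supremum minus infinity.\<close>

lemma J_bounded:
  obtains B where "\<And>k. k \<in> K \<Longrightarrow> ereal (- B) \<le> J_worst \<pi> x E_max mu lam \<gamma> c \<sigma> k"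
    "\<And>k. k \<in> K \<Longrightarrow> J_worst \<pi> x E_max mu lam \<gamma> c \<sigma> k \<le> J_best \<pi> x E_max mu lam \<gamma> c \<sigma> k"
    "\<And>k. k \<in> K \<Longrightarrow> J_best \<pi> x E_max mu lam \<gamma> c \<sigma> k \<le> ereal B"
proof -
  have "bounded (snd ` payoff_graph)"
    by (intro compact_imp_bounded compact_continuous_image compact_payoff_graph continuous_intros)
  then obtain B where "\<forall>j\<in>snd ` payoff_graph. \<bar>j\<bar> \<le> B"
    by (auto simp: bounded_iff)
  then have B: "- B \<le> j" "j \<le> B" if "(k, j) \<in> payoff_graph" for k j
    using that by (force simp: abs_le_iff)+
  show ?thesis
  proof (rule that[of B])
    fix k assume k: "k \<in> K"
    show "ereal (- B) \<le> J_worst \<pi> x E_max mu lam \<gamma> c \<sigma> k"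
      unfolding J_eq[OF k] by (intro INF_greatest) (simp add: B(1)[of k])
    show "J_worst \<pi> x E_max mu lam \<gamma> c \<sigma> k \<le> J_best \<pi> x E_max mu lam \<gamma> c \<sigma> k"
      unfolding J_worst_def J_best_def by (rule INF_le_SUP) (rule equilibria_nonempty[OF k])
    show "J_best \<pi> x E_max mu lam \<gamma> c \<sigma> k \<le> ereal B"
      unfolding J_eq[OF k] by (intro SUP_least) (simp add: B(2)[of k])
  qed
qed

text \<open>The fibre supremum and infimum of the payoff graph are Borel on the whole contract space
  and agree with the criteria on \<open>K\<close>. Outside \<open>K\<close> the fibres are empty, so
  the agreement is used only after restriction.\<close>

lemma J_measurable:
  "J_best \<pi> x E_max mu lam \<gamma> c \<sigma> \<in> borel_measurable (restrict_space borel K)"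
  "J_worst \<pi> x E_max mu lam \<gamma> c \<sigma> \<in> borel_measurable (restrict_space borel K)"
proof -
  note * = compact_graph_SUP_INF_measurable[OF compact_payoff_graph, THEN measurable_restrict_space1]
  show "J_best \<pi> x E_max mu lam \<gamma> c \<sigma> \<in> borel_measurable (restrict_space borel K)"
    by (subst measurable_cong[OF J_eq(1)]) (simp_all add: space_restrict_space *)
  show "J_worst \<pi> x E_max mu lam \<gamma> c \<sigma> \<in> borel_measurable (restrict_space borel K)"
    by (subst measurable_cong[OF J_eq(2)]) (simp_all add: space_restrict_space *)
qed

end

theorem corollary4p1:
  fixes \<pi> :: "'t measure"
    and x E_max p_max \<alpha>_max \<beta>_max \<gamma>_max c_max \<sigma>_max :: real
    and mu lam :: "real \<Rightarrow> real"
    and \<gamma> c \<sigma> :: "'t \<Rightarrow> real"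
  defines "K \<equiv> contract_set p_max \<alpha>_max \<beta>_max"
    and "Eq \<equiv> equilibria \<pi> x E_max mu lam \<gamma> c \<sigma>"
    and "Jw \<equiv> J_worst \<pi> x E_max mu lam \<gamma> c \<sigma>"
    and "Jb \<equiv> J_best \<pi> x E_max mu lam \<gamma> c \<sigma>"
  assumes "prob_space \<pi>"
    and "0 \<le> x" and "x < 1"
    and "\<And>z. 0 \<le> z \<Longrightarrow> 0 \<le> lam z"
    and "0 \<le> p_max" and "0 \<le> \<alpha>_max" and "0 \<le> \<beta>_max" and "\<beta>_max < 1"
    and "0 \<le> E_max"
    and "continuous_on {0..(1 + x) * E_max} mu" and "convex_on {0..(1 + x) * E_max} mu"
    and "continuous_on {0..(1 + x) * E_max} lam" and "convex_on {0..(1 + x) * E_max} lam"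
    and "\<gamma> \<in> borel_measurable \<pi>" and "c \<in> borel_measurable \<pi>" and "\<sigma> \<in> borel_measurable \<pi>"
    and "0 < \<gamma>_max" and "0 < c_max" and "0 < \<sigma>_max"
    and "\<And>\<theta>. \<theta> \<in> space \<pi> \<Longrightarrow> 0 < \<gamma> \<theta> \<and> \<gamma> \<theta> \<le> \<gamma>_max"
    and "\<And>\<theta>. \<theta> \<in> space \<pi> \<Longrightarrow> 0 \<le> c \<theta> \<and> c \<theta> \<le> c_max"
    and "\<And>\<theta>. \<theta> \<in> space \<pi> \<Longrightarrow> 0 \<le> \<sigma> \<theta> \<and> \<sigma> \<theta> \<le> \<sigma>_max"
  shows "(\<forall>k\<in>K. Eq k \<noteq> {}) \<and>
    well_defined_criterion K Jw \<and> well_defined_criterion K Jb \<and>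
    bounded_above_on K Jw \<and> bounded_above_on K Jb \<and>
    (\<forall>\<epsilon>::real. \<epsilon> > 0 \<longrightarrow>
      (\<exists>k_worst\<in>K. \<exists>k_best\<in>K.
        Jw k_worst \<ge> (SUP k\<in>K. Jw k) - ereal \<epsilon> \<and>
        Jb k_best \<ge> (SUP k\<in>K. Jb k) - ereal \<epsilon>))"
proof -
  have "0 < \<gamma> \<theta>" if "\<theta> \<in> space \<pi>" for \<theta>
    using assms that by blast
  then interpret insurance_market \<pi> x E_max p_max \<alpha>_max \<beta>_max mu lam \<gamma> c \<sigma>
    using assms by (intro insurance_market.intro insurance_market_axioms.intro)
  obtain B where B: "\<And>k. k \<in> K \<Longrightarrow> ereal (- B) \<le> Jw k" "\<And>k. k \<in> K \<Longrightarrow> Jw k \<le> Jb k"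
    "\<And>k. k \<in> K \<Longrightarrow> Jb k \<le> ereal B"
    unfolding K_def Jw_def Jb_def using J_bounded by blast
  have Jw_le: "Jw k \<le> ereal B" and Jb_ge: "ereal (- B) \<le> Jb k" if "k \<in> K" for k
    using B[OF that] by (auto intro: order_trans)
  have finite: "\<bar>Jw k\<bar> \<noteq> \<infinity>" "\<bar>Jb k\<bar> \<noteq> \<infinity>" if "k \<in> K" for k
    using B(1,3)[OF that] Jw_le[OF that] Jb_ge[OF that] by auto
  have "(0, 0, 0) \<in> K"
    using max_nonneg by (simp add: K_def contract_set_def)
  then have "K \<noteq> {}" by blast
  have "\<exists>k\<in>K. (SUP k\<in>K. Jw k) - ereal \<epsilon> \<le> Jw k" if "0 < \<epsilon>" for \<epsilon>
    by (rule ereal_SUP_approx[where B = B]) (fact \<open>K \<noteq> {}\<close> finite Jw_le that)+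
  moreover have "\<exists>k\<in>K. (SUP k\<in>K. Jb k) - ereal \<epsilon> \<le> Jb k" if "0 < \<epsilon>" for \<epsilon>
    by (rule ereal_SUP_approx[where B = B]) (fact \<open>K \<noteq> {}\<close> finite B(3) that)+
  moreover have "well_defined_criterion K Jw" "well_defined_criterion K Jb"
    using J_measurable finite unfolding well_defined_criterion_def K_def Jw_def Jb_def by auto
  moreover have "bounded_above_on K Jw" "bounded_above_on K Jb"
    using Jw_le B(3) unfolding bounded_above_on_def by blast+
  moreover have "\<forall>k\<in>K. Eq k \<noteq> {}"
    unfolding K_def Eq_def using equilibria_nonempty by blast
  ultimately show ?thesis by blast
qed

end
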